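(* Let $X$ be an ru-complete complex vector lattice with the property $(D)$. Every exponentially order bounded relatively uniformly continuous positive semigroup on $X$ is uniquely determined by its generator; that is, if $(S(t))_{t\ge0}$ and $(T(t))_{t\ge0}$ are exponentially order bounded relatively uniformly continuous positive semigroups on $X$ with the same generator (including the same domain), then $S(t)=T(t)$ for all $t\ge0$.
   Context: Complex vector lattices. A complex vector lattice $X=X_{\mathbb R}+iX_{\mathbb R}$ is the complexification of a (real, Archimedean) ru-complete vector lattice $X_{\mathbb R}$, with modulus $|x+iy|=\sup_{0\le\theta<2\pi}|\cos(\theta)x+\sin(\theta)y|\in X_{\mathbb R}$. Inequalities are understood in $X_{\mathbb R}$; elements used as upper bounds or regulators lie in the positive cone of $X_{\mathbb R}$. A linear operator on $X$ is positive if it maps the positive cone into itself. Relative uniform convergence. A net $(x_\alpha)$ in $X$ converges relatively uniformly to $x$ (written $x_\alpha\xrightarrow{ru}x$, or $\textup{ru-}\lim_\alpha x_\alpha=x$) if there is a regulator $u$ such that for each $\varepsilon>0$ there is $\alpha_0$ with $|x_\alpha-x|\le\varepsilon u$ for all $\alpha\ge\alpha_0$. A sequence is ru-Cauchy if there is a $u$ such that for each $\varepsilon>0$ there is $N$ with $|x_n-x_m|\le\varepsilon u$ for all $n,m\ge N$; the lattice is ru-complete if every ru-Cauchy sequence converges relatively uniformly. A subset $D\subset X$ is ru-dense if each $x\in X$ is the ru-limit of a sequence in $D$. Semigroups. A function $f:\mathbb{R}_+\to X$ is ru-continuous if there is $u:\mathbb{R}_+\to X$ such that for each $\varepsilon>0$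 there is $\delta>0$ with $|f(t+h)-f(t)|\le\varepsilon u(t)$ for all $t\ge0$ and $h\in[-\min\{\delta,t\},\delta]$. A relatively uniformly continuous semigroup (ruc-semigroup) is a family $(T(t))_{t\ge0}$ of linear operators on $X$ with $T(0)=I_X$, $T(t+s)=T(t)T(s)$ for all $s,t\ge0$, and all orbit maps $t\mapsto T(t)x$ ru-continuous; it is positive if every $T(t)$ is positive. Its generator is $Ax:=\textup{ru-}\lim_{h\searrow0}\frac1h(T(h)x-x)$ with domain $D(A)$ the set of all $x\in X$ for which this ru-limit exists in $X$. A semigroup is exponentially order bounded if there is $w\in\mathbb{R}$ such that for each $x\in X$ there is $u\in X$ with $|T(t)x|\le e^{wt}u$ for all $t\ge0$. Property $(D)$. $X$ has the property $(D)$ if for each net of linear operators $(T_\alpha)_\alpha$ on $X$ the following two assertions imply $T_\alpha x\xrightarrow{ru}0$ for each $x\in X$: (a) there is an ru-dense subset $D\subset X$ such that $T_\alpha y\xrightarrow{ru}0$ for each $y\in D$; (b) for each sequence $(x_n)$ in $X$ with $x_n\xrightarrow{ru}0$ there is a positive $u\in X$ such that for each $\varepsilon>0$ there exist $N_\varepsilon\in\mathbb{N}$ and $\alpha_\varepsilon$ with $|T_\alpha x_n|\le\varepsilon u$ for all $n\ge N_\varepsilon$ and $\alpha\ge\alpha_\varepsilon$. *)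

theory Defs
  imports "HOL-Analysis.Analysis" "HOL-Library.Lattice_Algebras"
begin

section \<open>Relative uniform convergence\<close>

class vector_lattice = ordered_real_vector + lattice_ab_group_add_abs

text \<open>
  The real lattice and its complexification share the following notions; the parameter \<open>md\<close>
  is the respective modulus, with values in the real lattice.
  A net consists of a nonempty set \<open>I\<close> directed by the preorder \<open>le\<close> and a family indexed by \<open>I\<close>.
\<close>

definition directed :: "'i set \<Rightarrow> ('i \<Rightarrow> 'i \<Rightarrow> bool) \<Rightarrow> bool" where
  "directed I le \<longleftrightarrow> I \<noteq> {} \<and> reflp_on I le \<and> transp_on I le \<and>
     (\<forall>a\<in>I. \<forall>b\<in>I. \<exists>c\<in>I. le a c \<and> le b c)"

definition ru_net_conv ::
  "('x::minus \<Rightarrow> 'a::vector_lattice) \<Rightarrow> 'i set \<Rightarrow> ('i \<Rightarrow> 'i \<Rightarrow> bool) \<Rightarrow> ('i \<Rightarrow> 'x) \<Rightarrow> 'x \<Rightarrow> bool" where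
  "ru_net_conv md I le X l \<longleftrightarrow>
     (\<exists>u\<ge>0. \<forall>\<epsilon>>0. \<exists>a\<in>I. \<forall>b\<in>I. le a b \<longrightarrow> md (X b - l) \<le> \<epsilon> *\<^sub>R u)"

definition ru_seq_conv ::
  "('x::minus \<Rightarrow> 'a::vector_lattice) \<Rightarrow> (nat \<Rightarrow> 'x) \<Rightarrow> 'x \<Rightarrow> bool" where
  "ru_seq_conv md = ru_net_conv md UNIV (\<le>)"

definition ru_Cauchy :: "('x::minus \<Rightarrow> 'a::vector_lattice) \<Rightarrow> (nat \<Rightarrow> 'x) \<Rightarrow> bool" where
  "ru_Cauchy md X \<longleftrightarrow>
     (\<exists>u\<ge>0. \<forall>\<epsilon>>0. \<exists>N. \<forall>n\<ge>N. \<forall>m\<ge>N. md (X n - X m) \<le> \<epsilon> *\<^sub>R u)"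

definition ru_complete :: "('x::minus \<Rightarrow> 'a::vector_lattice) \<Rightarrow> bool" where
  "ru_complete md \<longleftrightarrow> (\<forall>X. ru_Cauchy md X \<longrightarrow> (\<exists>l. ru_seq_conv md X l))"

definition ru_dense :: "('x::minus \<Rightarrow> 'a::vector_lattice) \<Rightarrow> 'x set \<Rightarrow> bool" where
  "ru_dense md D \<longleftrightarrow> (\<forall>x. \<exists>X. (\<forall>n. X n \<in> D) \<and> ru_seq_conv md X x)"

class ru_complete_vector_lattice = vector_lattice +
  assumes archimedean: "(\<And>n::nat. real n *\<^sub>R x \<le> y) \<Longrightarrow> x \<le> 0"
    and ru_Cauchy_imp_conv:
      "\<exists>u\<ge>0. \<forall>\<epsilon>>0. \<exists>N. \<forall>n\<ge>N. \<forall>m\<ge>N. \<bar>X n - X m\<bar> \<le> \<epsilon> *\<^sub>R u \<Longrightarrow>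
       \<exists>l. \<exists>u\<ge>0. \<forall>\<epsilon>>0. \<exists>N. \<forall>n\<ge>(N::nat). \<bar>X n - l\<bar> \<le> \<epsilon> *\<^sub>R u"

lemma ru_complete_abs: "ru_complete (abs :: 'a::ru_complete_vector_lattice \<Rightarrow> 'a)"
  unfolding ru_complete_def ru_Cauchy_def ru_seq_conv_def ru_net_conv_def
  by (simp only: UNIV_I bex_UNIV ball_UNIV) (blast intro: ru_Cauchy_imp_conv)

section \<open>Complex vector lattices\<close>

text \<open>
  The pair \<open>(x, y)\<close> stands for \<open>x + iy\<close>. Addition and real scalar multiplication are the
  componentwise ones of the product type.
\<close>

type_synonym 'a cvl = "'a \<times> 'a"

definition scaleC :: "complex \<Rightarrow> 'a::real_vector cvl \<Rightarrow> 'a cvl" where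
  "scaleC c z = (Re c *\<^sub>R fst z - Im c *\<^sub>R snd z, Im c *\<^sub>R fst z + Re c *\<^sub>R snd z)"

lemma vector_space_scaleC: "vector_space (scaleC :: complex \<Rightarrow> 'a::real_vector cvl \<Rightarrow> 'a cvl)"
  by unfold_locales (auto simp: scaleC_def prod_eq_iff algebra_simps)

lemma scaleC_of_real: "scaleC (of_real r) z = r *\<^sub>R z"
  by (simp add: scaleC_def prod_eq_iff)

abbreviation clinear_op :: "('a::real_vector cvl \<Rightarrow> 'a cvl) \<Rightarrow> bool" where
  "clinear_op \<equiv> Vector_Spaces.linear scaleC scaleC"

text \<open>
  The least upper bound of all \<open>\<bar>cos \<theta> x + sin \<theta> y\<bar>\<close>; it exists in every Archimedean
  ru-complete vector lattice.
\<close>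

definition modulus :: "'a::ru_complete_vector_lattice cvl \<Rightarrow> 'a" where
  "modulus z = (LEAST m. \<forall>\<theta>\<in>{0..<2 * pi}. \<bar>cos \<theta> *\<^sub>R fst z + sin \<theta> *\<^sub>R snd z\<bar> \<le> m)"

definition positive_op :: "('a::ru_complete_vector_lattice cvl \<Rightarrow> 'a cvl) \<Rightarrow> bool" where
  "positive_op T \<longleftrightarrow> (\<forall>x\<ge>0. \<exists>y\<ge>0. T (x, 0) = (y, 0))"

section \<open>Semigroups\<close>

definition ru_continuous :: "(real \<Rightarrow> 'a::ru_complete_vector_lattice cvl) \<Rightarrow> bool" where
  "ru_continuous f \<longleftrightarrow>
     (\<exists>u :: real \<Rightarrow> 'a. (\<forall>t\<ge>0. 0 \<le> u t) \<and>
        (\<forall>\<epsilon>>0. \<exists>\<delta>>0. \<forall>t\<ge>0. \<forall>h\<in>{- min \<delta> t..\<delta>}. modulus (f (t + h) - f t) \<le> \<epsilon> *\<^sub>R u t))"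

text \<open>Families on the nonnegative reals; values at negative times are irrelevant.\<close>

definition ruc_semigroup ::
  "(real \<Rightarrow> 'a::ru_complete_vector_lattice cvl \<Rightarrow> 'a cvl) \<Rightarrow> bool" where
  "ruc_semigroup T \<longleftrightarrow>
     (\<forall>t\<ge>0. clinear_op (T t)) \<and> T 0 = id \<and>
     (\<forall>s\<ge>0. \<forall>t\<ge>0. T (t + s) = T t \<circ> T s) \<and>
     (\<forall>x. ru_continuous (\<lambda>t. T t x))"

definition positive_semigroup ::
  "(real \<Rightarrow> 'a::ru_complete_vector_lattice cvl \<Rightarrow> 'a cvl) \<Rightarrow> bool" where
  "positive_semigroup T \<longleftrightarrow> (\<forall>t\<ge>0. positive_op (T t))"

definition exp_order_bounded ::
  "(real \<Rightarrow> 'a::ru_complete_vector_lattice cvl \<Rightarrow> 'a cvl) \<Rightarrow> bool" where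
  "exp_order_bounded T \<longleftrightarrow>
     (\<exists>w::real. \<forall>x. \<exists>u\<ge>0. \<forall>t\<ge>0. modulus (T t x) \<le> exp (w * t) *\<^sub>R u)"

text \<open>\<open>h \<searrow> 0\<close> is the net of all \<open>h > 0\<close>, directed downwards.\<close>

definition ru_deriv_at_0 ::
  "(real \<Rightarrow> 'a::ru_complete_vector_lattice cvl \<Rightarrow> 'a cvl) \<Rightarrow> 'a cvl \<Rightarrow> 'a cvl \<Rightarrow> bool" where
  "ru_deriv_at_0 T x y \<longleftrightarrow>
     ru_net_conv modulus {0<..} (\<ge>) (\<lambda>h. (1 / h) *\<^sub>R (T h x - x)) y"

definition generator_dom ::
  "(real \<Rightarrow> 'a::ru_complete_vector_lattice cvl \<Rightarrow> 'a cvl) \<Rightarrow> 'a cvl set" where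
  "generator_dom T = {x. \<exists>y. ru_deriv_at_0 T x y}"

definition generator ::
  "(real \<Rightarrow> 'a::ru_complete_vector_lattice cvl \<Rightarrow> 'a cvl) \<Rightarrow> 'a cvl \<Rightarrow> 'a cvl" where
  "generator T x = (THE y. ru_deriv_at_0 T x y)"

section \<open>Property (D)\<close>

definition property_D_indexed ::
  "'a::ru_complete_vector_lattice itself \<Rightarrow> 'i itself \<Rightarrow> bool" where
  "property_D_indexed _ _ \<longleftrightarrow>
     (\<forall>(I :: 'i set) le (T :: 'i \<Rightarrow> 'a cvl \<Rightarrow> 'a cvl).
        directed I le \<longrightarrow> (\<forall>a\<in>I. clinear_op (T a)) \<longrightarrow>
        (\<exists>D. ru_dense modulus D \<and> (\<forall>y\<in>D. ru_net_conv modulus I le (\<lambda>a. T a y) 0)) \<longrightarrow>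
        (\<forall>X. ru_seq_conv modulus X 0 \<longrightarrow>
           (\<exists>u\<ge>0. \<forall>\<epsilon>>0. \<exists>N. \<exists>a\<in>I. \<forall>n\<ge>N. \<forall>b\<in>I. le a b \<longrightarrow>
              modulus (T b (X n)) \<le> \<epsilon> *\<^sub>R u)) \<longrightarrow>
        (\<forall>x. ru_net_conv modulus I le (\<lambda>a. T a x) 0))"

text \<open>
  Index types cannot be quantified over inside a formula. The index type chosen here is large
  enough: by the lemma \<open>property_D_all_nets\<close> below, it yields the property for nets indexed by
  arbitrary directed sets of arbitrary type.
\<close>

definition property_D :: "'a::ru_complete_vector_lattice itself \<Rightarrow> bool" where
  "property_D _ \<longleftrightarrow> property_D_indexed TYPE('a)
     TYPE(('a cvl \<Rightarrow> 'a cvl) \<times> ('a cvl \<Rightarrow> 'a cvl) set)"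

definition tail :: "'i set \<Rightarrow> ('i \<Rightarrow> 'i \<Rightarrow> bool) \<Rightarrow> ('i \<Rightarrow> 'b) \<Rightarrow> 'i \<Rightarrow> 'b set" where
  "tail I le T a = T ` {b \<in> I. le a b}"

definition tail_index :: "'i set \<Rightarrow> ('i \<Rightarrow> 'i \<Rightarrow> bool) \<Rightarrow> ('i \<Rightarrow> 'b) \<Rightarrow> ('b \<times> 'b set) set" where
  "tail_index I le T = {(T b, tail I le T a) | a b. a \<in> I \<and> b \<in> I \<and> le a b}"

definition tail_le :: "'b \<times> 'b set \<Rightarrow> 'b \<times> 'b set \<Rightarrow> bool" where
  "tail_le p q \<longleftrightarrow> snd q \<subseteq> snd p"

lemma tail_antimono:
  assumes "directed I le" "a \<in> I" "b \<in> I" "le a b"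
  shows "tail I le T b \<subseteq> tail I le T a"
proof -
  have "transp_on I le" using assms(1) by (simp add: directed_def)
  then have "le a c" if "c \<in> I" "le b c" for c
    using assms that by (meson transp_onD)
  then show ?thesis by (auto simp: tail_def)
qed

lemma tail_index_eventually:
  assumes "directed I le"
  shows "(\<exists>p\<in>tail_index I le T. \<forall>q\<in>tail_index I le T. tail_le p q \<longrightarrow> P (fst q)) \<longleftrightarrow>
         (\<exists>a\<in>I. \<forall>b\<in>I. le a b \<longrightarrow> P (T b))" (is "?L \<longleftrightarrow> ?R")
proof
  have refl: "le a a" if "a \<in> I" for a
    using assms that by (auto simp: directed_def reflp_on_def)
  {
    assume ?L
    then obtain a b where ab: "a \<in> I" "b \<in> I" "le a b"
      and P: "\<And>q. q \<in> tail_index I le T \<Longrightarrow> snd q \<subseteq> tail I le T a \<Longrightarrow> P (fst q)"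
      unfolding tail_index_def tail_le_def by fastforce
    have "P (T c)" if c: "c \<in> I" "le a c" for c
    proof -
      have "(T c, tail I le T c) \<in> tail_index I le T"
        using c refl unfolding tail_index_def by blast
      from P[OF this] show ?thesis using tail_antimono[OF assms ab(1) c, of T] by simp
    qed
    with ab show ?R by blast
  }
  assume ?R
  then obtain a where a: "a \<in> I" and P: "\<And>b. b \<in> I \<Longrightarrow> le a b \<Longrightarrow> P (T b)" by blast
  have "(T a, tail I le T a) \<in> tail_index I le T"
    using a refl unfolding tail_index_def by blast
  moreover have "P (fst q)" if "q \<in> tail_index I le T" "tail_le (T a, tail I le T a) q" for q
  proof -
    have "fst q \<in> snd q" using that(1) by (auto simp: tail_index_def tail_def)
    with that(2) have "fst q \<in> tail I le T a" by (auto simp: tail_le_def)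
    then show ?thesis using P by (auto simp: tail_def)
  qed
  ultimately show ?L by blast
qed

lemma directed_tail_index:
  assumes "directed I le"
  shows "directed (tail_index I le T) tail_le"
proof -
  have refl: "le a a" if "a \<in> I" for a
    using assms that by (auto simp: directed_def reflp_on_def)
  obtain a where "a \<in> I" using assms by (auto simp: directed_def)
  then have "tail_index I le T \<noteq> {}" using refl unfolding tail_index_def by blast
  moreover have "\<exists>r\<in>tail_index I le T. tail_le p r \<and> tail_le q r"
    if pq: "p \<in> tail_index I le T" "q \<in> tail_index I le T" for p q
  proof -
    obtain a a' where a: "a \<in> I" "snd p = tail I le T a" "a' \<in> I" "snd q = tail I le T a'"
      using pq by (auto simp: tail_index_def)
    obtain c where c: "c \<in> I" "le a c" "le a' c"
      using assms a unfolding directed_def by metis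
    have "(T c, tail I le T c) \<in> tail_index I le T"
      using c refl unfolding tail_index_def by blast
    moreover have "tail_le p (T c, tail I le T c)" "tail_le q (T c, tail I le T c)"
      using a c by (simp_all add: tail_le_def tail_antimono[OF assms])
    ultimately show ?thesis by blast
  qed
  ultimately show ?thesis
    by (auto simp: directed_def reflp_on_def transp_on_def tail_le_def)
qed

lemma ru_net_conv_tail_index:
  assumes "directed I le"
  shows "ru_net_conv md (tail_index I le T) tail_le (\<lambda>p. fst p x) l \<longleftrightarrow>
         ru_net_conv md I le (\<lambda>a. T a x) l"
  unfolding ru_net_conv_def tail_index_eventually[OF assms, of T "\<lambda>f. md (f x - l) \<le> _"] ..

lemma property_D_all_nets:
  assumes "property_D TYPE('a::ru_complete_vector_lattice)"
  shows "property_D_indexed TYPE('a) TYPE('i)"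
  unfolding property_D_indexed_def
proof (intro allI impI)
  fix I :: "'i set" and le and T :: "'i \<Rightarrow> 'a cvl \<Rightarrow> 'a cvl" and x
  assume dir: "directed I le"
    and lin: "\<forall>a\<in>I. clinear_op (T a)"
    and D: "\<exists>D. ru_dense modulus D \<and> (\<forall>y\<in>D. ru_net_conv modulus I le (\<lambda>a. T a y) 0)"
    and seq: "\<forall>X. ru_seq_conv modulus X 0 \<longrightarrow>
           (\<exists>u\<ge>0. \<forall>\<epsilon>>0. \<exists>N. \<exists>a\<in>I. \<forall>n\<ge>N. \<forall>b\<in>I. le a b \<longrightarrow>
              modulus (T b (X n)) \<le> \<epsilon> *\<^sub>R u)"
  let ?J = "tail_index I le T"
  note ev = tail_index_eventually[OF dir, of T]
  have swap: "(\<exists>a\<in>K. \<forall>n\<ge>N. \<forall>b\<in>K. r a b \<longrightarrow> Q n b) \<longleftrightarrow>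
      (\<exists>a\<in>K. \<forall>b\<in>K. r a b \<longrightarrow> (\<forall>n\<ge>N. Q n b))"
    for K r and Q :: "nat \<Rightarrow> 'k \<Rightarrow> bool" and N :: nat
    by blast
  have seq': "\<exists>u\<ge>0. \<forall>\<epsilon>>0. \<exists>N. \<exists>a\<in>?J. \<forall>n\<ge>N. \<forall>b\<in>?J. tail_le a b \<longrightarrow>
              modulus (fst b (X n)) \<le> \<epsilon> *\<^sub>R u" if "ru_seq_conv modulus X 0" for X
    using seq[rule_format, OF that]
    unfolding swap ev[of "\<lambda>f. \<forall>n\<ge>_. modulus (f (X n)) \<le> _"] .
  have lin': "\<forall>p\<in>?J. clinear_op (fst p)" using lin by (auto simp: tail_index_def)
  have "ru_net_conv modulus ?J tail_le (\<lambda>p. fst p x) 0"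
    using assms[unfolded property_D_def property_D_indexed_def, rule_format,
        of ?J tail_le fst x] directed_tail_index[OF dir] lin' D seq'
    unfolding ru_net_conv_tail_index[OF dir] by blast
  then show "ru_net_conv modulus I le (\<lambda>a. T a x) 0"
    unfolding ru_net_conv_tail_index[OF dir] .
qed

end

theory Submission
  imports Defs
begin

text \<open>
  Positive operators map the real lattice into itself, so everything is settled for semigroups of
  positive operators on the real lattice; complex linearity brings the result back. Let \<open>A\<close> be the
  common generator of \<open>S\<close> and \<open>T\<close>.

  The classical argument differentiates \<open>r \<mapsto> T (t - r) (S r x)\<close> and finds the derivative zero. Here
  that is not enough: the regulator of the derivative of \<open>T\<close> at the point \<open>S r x\<close> depends on \<open>r\<close>,
  and infinitely many regulators need not have a common upper bound, so that pointwise derivatives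
  do not control increments. For \<open>x\<close> in the domain of \<open>A\<^sup>2\<close> this obstacle disappears. The
  telescoping estimate \<open>mean_value_estimate\<close>, used twice, gives a Taylor bound
  (\<open>second_order_estimate\<close>)

    \<open>\<bar>T h y - y - h A y\<bar> \<le> h\<^sup>2 B\<close>  whenever  \<open>\<bar>T \<sigma> (A\<^sup>2 y)\<bar> \<le> B\<close> for \<open>0 \<le> \<sigma> \<le> h\<close>,

  in which the regulators belonging to the individual derivatives have vanished in a limit. For
  \<open>y = S r x\<close> we have \<open>A\<^sup>2 y = S r (A\<^sup>2 x)\<close>, and positivity makes \<open>B\<close> independent of \<open>r\<close>: if
  \<open>\<bar>S r (A\<^sup>2 x)\<bar> \<le> a\<close> for all \<open>r \<le> t\<close>, then \<open>\<bar>T \<sigma> (S r (A\<^sup>2 x))\<bar> \<le> T \<sigma> a\<close>, and the orbit of \<open>a\<close>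
  is bounded on \<open>[0, t]\<close>. As \<open>S\<close> satisfies the same bound, \<open>S h\<close> and \<open>T h\<close> differ on the whole orbit
  of \<open>x\<close> by at most a multiple of \<open>h\<^sup>2\<close>. Adding up \<open>n\<close> steps of length \<open>t / n\<close> bounds
  \<open>\<bar>S t x - T t x\<bar>\<close> by a multiple of \<open>1 / n\<close>, so \<open>S t x = T t x\<close> (\<open>agree_on_gen_square\<close>).

  It remains to reach all \<open>x\<close>. Completeness yields the integral \<open>F r\<close> of the orbit of \<open>x\<close> under \<open>S\<close>
  over \<open>[0, r]\<close>. It lies in the domain of \<open>A\<close>, with \<open>A (F r) = S r x - x\<close>, and \<open>F r / r\<close> comes
  arbitrarily close to \<open>x\<close> (\<open>orbit_integral\<close>). If \<open>x\<close> is in the domain of \<open>A\<close>, then so is \<open>S r x - x\<close>, that is, \<open>F r\<close>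
  is in the domain of \<open>A\<^sup>2\<close>. Since positive operators preserve relative uniform limits, equality of
  the semigroups passes from the domain of \<open>A\<^sup>2\<close> to that of \<open>A\<close>, and from there to the whole lattice.
\<close>

section \<open>Estimates in vector lattices\<close>

lemma le_if_le_add_eps:
  fixes x y u :: "'a::ru_complete_vector_lattice"
  assumes "\<And>\<epsilon>. \<epsilon> > 0 \<Longrightarrow> x \<le> y + \<epsilon> *\<^sub>R u"
  shows "x \<le> y"
proof -
  have "real n *\<^sub>R (x - y) \<le> \<bar>u\<bar>" for n :: nat
  proof (cases "n = 0")
    case False
    then have "x - y \<le> (1 / real n) *\<^sub>R u"
      using assms[of "1 / real n"] by (simp add: diff_le_eq add.commute)
    then have "real n *\<^sub>R (x - y) \<le> real n *\<^sub>R ((1 / real n) *\<^sub>R u)"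
      by (intro scaleR_left_mono) auto
    also have "\<dots> = u" using False by simp
    also have "\<dots> \<le> \<bar>u\<bar>" by (rule abs_ge_self)
    finally show ?thesis .
  qed simp
  from archimedean[OF this] show ?thesis by simp
qed

lemma abs_scaleR_le:
  fixes x :: "'a::vector_lattice"
  assumes "\<bar>x\<bar> \<le> u" "0 \<le> r"
  shows "\<bar>r *\<^sub>R x\<bar> \<le> r *\<^sub>R u"
  using assms scaleR_left_mono[of x u r] scaleR_left_mono[of "- x" u r]
  by (auto simp: abs_le_iff)

lemma abs_scaleR_abs_le:
  fixes x :: "'a::vector_lattice"
  shows "\<bar>r *\<^sub>R x\<bar> \<le> \<bar>r\<bar> *\<^sub>R \<bar>x\<bar>"
  using abs_scaleR_le[of x "\<bar>x\<bar>" "\<bar>r\<bar>"] by (cases "0 \<le> r") (auto simp: not_le)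

lemma abs_scaleR_le_of_abs_le:
  fixes x :: "'a::vector_lattice"
  assumes "\<bar>r\<bar> \<le> c"
  shows "\<bar>r *\<^sub>R x\<bar> \<le> c *\<^sub>R \<bar>x\<bar>"
  using abs_scaleR_abs_le scaleR_right_mono[OF assms abs_ge_zero] by (rule order_trans)

lemma abs_add_le:
  fixes x y :: "'a::vector_lattice"
  assumes "\<bar>x\<bar> \<le> u" "\<bar>y\<bar> \<le> v"
  shows "\<bar>x + y\<bar> \<le> u + v"
  by (rule order_trans[OF abs_triangle_ineq]) (intro add_mono assms)

lemma abs_diff_le:
  fixes x y :: "'a::vector_lattice"
  assumes "\<bar>x\<bar> \<le> u" "\<bar>y\<bar> \<le> v"
  shows "\<bar>x - y\<bar> \<le> u + v"
  using abs_add_le[of x u "- y" v] assms by simp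

lemma abs_sum_lessThan_le:
  fixes f :: "nat \<Rightarrow> 'a::vector_lattice"
  assumes "\<And>k. k < n \<Longrightarrow> \<bar>f k\<bar> \<le> u"
  shows "\<bar>\<Sum>k<n. f k\<bar> \<le> real n *\<^sub>R u"
proof -
  have "\<bar>\<Sum>k<n. f k\<bar> \<le> (\<Sum>k<n. \<bar>f k\<bar>)" by (rule sum_abs)
  also have "\<dots> \<le> (\<Sum>k<n. u)" using assms by (intro sum_mono) auto
  also have "\<dots> = real n *\<^sub>R u" by (simp only: sum_constant_scaleR card_lessThan)
  finally show ?thesis .
qed

lemma sum_lessThan_add:
  fixes f :: "nat \<Rightarrow> 'a::ab_group_add"
  shows "(\<Sum>k<n + m. f k) = (\<Sum>k<n. f k) + (\<Sum>k<m. f (n + k))"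
  by (induction m) (auto simp: algebra_simps)

lemma ex_small_mesh:
  fixes s \<delta> :: real
  assumes "\<delta> > 0" "0 \<le> s"
  shows "\<exists>N>0. \<forall>n\<ge>N. s / real n \<le> \<delta>"
proof -
  obtain N :: nat where N: "s / \<delta> < real N" using reals_Archimedean2 by blast
  then have "N > 0" using assms by (cases N) (auto simp: field_simps zero_less_divide_iff not_less)
  moreover have "s / real n \<le> \<delta>" if "n \<ge> N" for n
  proof -
    have "s / \<delta> \<le> real n" using N that by linarith
    moreover have "real n > 0" using that \<open>N > 0\<close> by simp
    ultimately show ?thesis using assms by (simp add: field_simps)
  qed
  ultimately show ?thesis by blast
qed

section \<open>Semigroups of positive operators on the real lattice\<close>

text \<open>
  Continuity is required at \<open>0\<close> only: since \<open>S (t + h) x - S t x = S t (S h x - x)\<close>, it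
  spreads to bounded intervals, with one regulator, through the local bounds on orbits.
\<close>

locale positive_ru_semigroup =
  fixes S :: "real \<Rightarrow> 'a::ru_complete_vector_lattice \<Rightarrow> 'a"
  assumes linear: "0 \<le> t \<Longrightarrow> linear (S t)"
    and nonneg: "0 \<le> t \<Longrightarrow> 0 \<le> x \<Longrightarrow> 0 \<le> S t x"
    and zero: "S 0 x = x"
    and add: "0 \<le> s \<Longrightarrow> 0 \<le> t \<Longrightarrow> S (s + t) x = S s (S t x)"
    and continuous_at_0: "\<exists>u\<ge>0. \<forall>\<epsilon>>0. \<exists>\<delta>>0. \<forall>h. 0 \<le> h \<and> h \<le> \<delta> \<longrightarrow> \<bar>S h x - x\<bar> \<le> \<epsilon> *\<^sub>R u"
    and locally_bounded: "\<exists>u\<ge>0. \<forall>s. 0 \<le> s \<and> s \<le> t \<longrightarrow> \<bar>S s x\<bar> \<le> u"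
begin

lemmas diff = linear_diff[OF linear] and scale = linear_scale[OF linear]
  and sum = linear_sum[OF linear]

lemma commute: "0 \<le> s \<Longrightarrow> 0 \<le> t \<Longrightarrow> S s (S t x) = S t (S s x)"
  using add[of s t x] add[of t s x] by (simp add: add.commute)

lemma mono: "0 \<le> t \<Longrightarrow> x \<le> y \<Longrightarrow> S t x \<le> S t y"
  using nonneg[of t "y - x"] by (simp add: diff)

lemma abs_le:
  assumes "0 \<le> t" "\<bar>x\<bar> \<le> u"
  shows "\<bar>S t x\<bar> \<le> S t u"
  using assms mono[of t x u] mono[of t "- x" u] linear_neg[OF linear, of t x]
  by (auto simp: abs_le_iff)

text \<open>
  This is how regulators stay uniform: on a bounded time interval all the operators send estimates
  with regulator \<open>u\<close> to estimates with one and the same regulator \<open>u'\<close>.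
\<close>

lemma regulator:
  assumes "0 \<le> u"
  obtains u' where "0 \<le> u'"
    and "\<And>s c z. \<lbrakk>0 \<le> s; s \<le> t; 0 \<le> c; \<bar>z\<bar> \<le> c *\<^sub>R u\<rbrakk> \<Longrightarrow> \<bar>S s z\<bar> \<le> c *\<^sub>R u'"
proof -
  obtain u' where u': "0 \<le> u'" "\<And>s. 0 \<le> s \<Longrightarrow> s \<le> t \<Longrightarrow> \<bar>S s u\<bar> \<le> u'"
    using locally_bounded[of t u] by blast
  have "\<bar>S s z\<bar> \<le> c *\<^sub>R u'" if "0 \<le> s" "s \<le> t" "0 \<le> c" "\<bar>z\<bar> \<le> c *\<^sub>R u" for s c z
  proof -
    have "\<bar>S s z\<bar> \<le> S s (c *\<^sub>R u)" using that by (intro abs_le) auto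
    also have "\<dots> = c *\<^sub>R S s u" using that by (simp add: scale)
    also have "\<dots> \<le> c *\<^sub>R u'"
      using u'(2)[OF that(1,2)] that by (intro scaleR_left_mono) (auto simp: abs_le_iff)
    finally show ?thesis .
  qed
  with u'(1) show ?thesis using that by blast
qed

text \<open>
  The graph of the generator, with the difference quotient multiplied by \<open>h\<close> so that the errors
  of consecutive steps can be added.
\<close>

definition gen :: "'a \<Rightarrow> 'a \<Rightarrow> bool" where
  "gen x y \<longleftrightarrow> (\<exists>u\<ge>0. \<forall>\<epsilon>>0. \<exists>\<delta>>0. \<forall>h. 0 < h \<and> h \<le> \<delta> \<longrightarrow>
     \<bar>S h x - x - h *\<^sub>R y\<bar> \<le> (\<epsilon> * h) *\<^sub>R u)"

lemma gen_orbit: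
  assumes "gen x y" "0 \<le> r"
  shows "gen (S r x) (S r y)"
proof -
  obtain u where u: "0 \<le> u" "\<And>\<epsilon>. \<epsilon> > 0 \<Longrightarrow> \<exists>\<delta>>0. \<forall>h. 0 < h \<and> h \<le> \<delta> \<longrightarrow>
     \<bar>S h x - x - h *\<^sub>R y\<bar> \<le> (\<epsilon> * h) *\<^sub>R u"
    using assms(1) unfolding gen_def by blast
  obtain u' where u': "0 \<le> u'"
    "\<And>s c z. \<lbrakk>0 \<le> s; s \<le> r; 0 \<le> c; \<bar>z\<bar> \<le> c *\<^sub>R u\<rbrakk> \<Longrightarrow> \<bar>S s z\<bar> \<le> c *\<^sub>R u'"
    using regulator[OF u(1), of r] by blast
  have "\<exists>\<delta>>0. \<forall>h. 0 < h \<and> h \<le> \<delta> \<longrightarrow>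
      \<bar>S h (S r x) - S r x - h *\<^sub>R S r y\<bar> \<le> (\<epsilon> * h) *\<^sub>R u'" if \<epsilon>: "\<epsilon> > 0" for \<epsilon>
  proof -
    obtain \<delta> where \<delta>: "\<delta> > 0" "\<And>h. 0 < h \<Longrightarrow> h \<le> \<delta> \<Longrightarrow>
        \<bar>S h x - x - h *\<^sub>R y\<bar> \<le> (\<epsilon> * h) *\<^sub>R u"
      using u(2)[OF \<epsilon>] by blast
    have "\<bar>S h (S r x) - S r x - h *\<^sub>R S r y\<bar> \<le> (\<epsilon> * h) *\<^sub>R u'" if h: "0 < h" "h \<le> \<delta>" for h
    proof -
      have "S h (S r x) - S r x - h *\<^sub>R S r y = S r (S h x - x - h *\<^sub>R y)"
        using h assms(2) commute[of h r x] by (simp add: diff scale)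
      also have "\<bar>\<dots>\<bar> \<le> (\<epsilon> * h) *\<^sub>R u'"
        using h assms(2) \<epsilon> \<delta>(2)[OF h] by (intro u'(2)) auto
      finally show ?thesis .
    qed
    with \<delta>(1) show ?thesis by blast
  qed
  with u'(1) show ?thesis unfolding gen_def by blast
qed

lemma gen_diff:
  assumes "gen x y" "gen x' y'"
  shows "gen (x - x') (y - y')"
proof -
  obtain u where u: "0 \<le> u" "\<And>\<epsilon>. \<epsilon> > 0 \<Longrightarrow> \<exists>\<delta>>0. \<forall>h. 0 < h \<and> h \<le> \<delta> \<longrightarrow>
     \<bar>S h x - x - h *\<^sub>R y\<bar> \<le> (\<epsilon> * h) *\<^sub>R u"
    using assms(1) unfolding gen_def by blast
  obtain u' where u': "0 \<le> u'" "\<And>\<epsilon>. \<epsilon> > 0 \<Longrightarrow> \<exists>\<delta>>0. \<forall>h. 0 < h \<and> h \<le> \<delta> \<longrightarrow>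
     \<bar>S h x' - x' - h *\<^sub>R y'\<bar> \<le> (\<epsilon> * h) *\<^sub>R u'"
    using assms(2) unfolding gen_def by blast
  have "\<exists>\<delta>>0. \<forall>h. 0 < h \<and> h \<le> \<delta> \<longrightarrow>
      \<bar>S h (x - x') - (x - x') - h *\<^sub>R (y - y')\<bar> \<le> (\<epsilon> * h) *\<^sub>R (u + u')" if \<epsilon>: "\<epsilon> > 0" for \<epsilon>
  proof -
    obtain \<delta> \<delta>' where \<delta>: "\<delta> > 0" "\<And>h. 0 < h \<Longrightarrow> h \<le> \<delta> \<Longrightarrow>
        \<bar>S h x - x - h *\<^sub>R y\<bar> \<le> (\<epsilon> * h) *\<^sub>R u"
      and \<delta>': "\<delta>' > 0" "\<And>h. 0 < h \<Longrightarrow> h \<le> \<delta>' \<Longrightarrow>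
        \<bar>S h x' - x' - h *\<^sub>R y'\<bar> \<le> (\<epsilon> * h) *\<^sub>R u'"
      using u(2)[OF \<epsilon>] u'(2)[OF \<epsilon>] by blast
    have "\<bar>S h (x - x') - (x - x') - h *\<^sub>R (y - y')\<bar> \<le> (\<epsilon> * h) *\<^sub>R (u + u')"
      if h: "0 < h" "h \<le> min \<delta> \<delta>'" for h
    proof -
      have "S h (x - x') - (x - x') - h *\<^sub>R (y - y')
          = (S h x - x - h *\<^sub>R y) - (S h x' - x' - h *\<^sub>R y')"
        using h by (simp add: diff algebra_simps)
      also have "\<bar>\<dots>\<bar> \<le> (\<epsilon> * h) *\<^sub>R u + (\<epsilon> * h) *\<^sub>R u'"
        using h by (intro abs_diff_le \<delta> \<delta>') auto
      finally show ?thesis by (simp add: scaleR_add_right)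
    qed
    with \<delta>(1) \<delta>'(1) show ?thesis by (intro exI[of _ "min \<delta> \<delta>'"]) auto
  qed
  with u(1) u'(1) show ?thesis unfolding gen_def
    by (intro exI[of _ "u + u'"]) auto
qed

text \<open>
  On a mesh of width \<open>d\<close>, the increment of \<open>S _ y\<close> from \<open>k d\<close> to \<open>(k + 1) d\<close> is
  \<open>S (k d) (S d y - y)\<close>, which is \<open>d\<close> times \<open>S (k d) v\<close> up to a small multiple of \<open>d u'\<close>. The
  regulator \<open>u'\<close> comes from the derivative at the single point \<open>y\<close>, and the Archimedean property
  removes it as the mesh is refined: the bound involves \<open>B\<close> alone.
\<close>

lemma mean_value_estimate:
  assumes y: "gen y v" and s: "0 \<le> s"
    and B: "\<And>\<sigma>. 0 \<le> \<sigma> \<Longrightarrow> \<sigma> \<le> s \<Longrightarrow> \<bar>S \<sigma> v - c\<bar> \<le> B"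
  shows "\<bar>S s y - y - s *\<^sub>R c\<bar> \<le> s *\<^sub>R B"
proof (cases "s = 0")
  case True
  then show ?thesis by (simp add: zero)
next
  case False
  with s have s: "s > 0" by simp
  obtain u where u: "0 \<le> u" "\<And>\<epsilon>. \<epsilon> > 0 \<Longrightarrow> \<exists>\<delta>>0. \<forall>h. 0 < h \<and> h \<le> \<delta> \<longrightarrow>
     \<bar>S h y - y - h *\<^sub>R v\<bar> \<le> (\<epsilon> * h) *\<^sub>R u"
    using y unfolding gen_def by blast
  obtain u' where u': "0 \<le> u'"
    "\<And>\<sigma> c z. \<lbrakk>0 \<le> \<sigma>; \<sigma> \<le> s; 0 \<le> c; \<bar>z\<bar> \<le> c *\<^sub>R u\<rbrakk> \<Longrightarrow> \<bar>S \<sigma> z\<bar> \<le> c *\<^sub>R u'"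
    using regulator[OF u(1), of s] by blast
  show ?thesis
  proof (rule le_if_le_add_eps[where u = "s *\<^sub>R u'"])
    fix \<epsilon> :: real assume \<epsilon>: "\<epsilon> > 0"
    obtain \<delta> where \<delta>: "\<delta> > 0" "\<And>h. 0 < h \<Longrightarrow> h \<le> \<delta> \<Longrightarrow>
        \<bar>S h y - y - h *\<^sub>R v\<bar> \<le> (\<epsilon> * h) *\<^sub>R u"
      using u(2)[OF \<epsilon>] by blast
    obtain n :: nat where n: "n > 0" "s / real n \<le> \<delta>"
      using ex_small_mesh[OF \<delta>(1) order_less_imp_le[OF s]] by blast
    define d where "d = s / real n"
    have d: "d > 0" "d \<le> \<delta>" "real n * d = s" using n s by (auto simp: d_def)
    have "(\<Sum>k<n. S (real (Suc k) * d) y - S (real k * d) y) = S (real n * d) y - S (real 0 * d) y"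
      by (rule sum_lessThan_telescope)
    then have "S s y - y - s *\<^sub>R c = (\<Sum>k<n. (S (real (Suc k) * d) y - S (real k * d) y) - d *\<^sub>R c)"
      unfolding sum_subtractf[of _ "\<lambda>_. d *\<^sub>R c"] sum_constant_scaleR
      by (simp add: d zero)
    also have "\<bar>\<dots>\<bar> \<le> real n *\<^sub>R ((\<epsilon> * d) *\<^sub>R u' + d *\<^sub>R B)"
    proof (rule abs_sum_lessThan_le)
      fix k assume "k < n"
      then have "real k * d \<le> real n * d" using d by (intro mult_right_mono) auto
      then have kd: "0 \<le> real k * d" "real k * d \<le> s" using d by auto
      have "S (real (Suc k) * d) y = S (real k * d) (S d y)"
        using add[OF kd(1) order_less_imp_le[OF d(1)], of y] by (simp add: algebra_simps)
      then have "S (real (Suc k) * d) y - S (real k * d) y - d *\<^sub>R c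
          = S (real k * d) (S d y - y - d *\<^sub>R v) + d *\<^sub>R (S (real k * d) v - c)"
        using kd by (simp add: diff scale scaleR_diff_right)
      also have "\<bar>\<dots>\<bar> \<le> (\<epsilon> * d) *\<^sub>R u' + d *\<^sub>R B"
        using kd d \<epsilon> by (intro abs_add_le u'(2) \<delta>(2) abs_scaleR_le B) auto
      finally show "\<bar>S (real (Suc k) * d) y - S (real k * d) y - d *\<^sub>R c\<bar>
          \<le> (\<epsilon> * d) *\<^sub>R u' + d *\<^sub>R B" .
    qed
    also have "\<dots> = s *\<^sub>R B + \<epsilon> *\<^sub>R s *\<^sub>R u'"
      unfolding d(3)[symmetric] by (simp add: scaleR_add_right ac_simps)
    finally show "\<bar>S s y - y - s *\<^sub>R c\<bar> \<le> s *\<^sub>R B + \<epsilon> *\<^sub>R s *\<^sub>R u'" .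
  qed
qed

lemma second_order_estimate:
  assumes "gen y v" "gen v w" "0 \<le> h"
    and B: "\<And>\<sigma>. 0 \<le> \<sigma> \<Longrightarrow> \<sigma> \<le> h \<Longrightarrow> \<bar>S \<sigma> w\<bar> \<le> B"
  shows "\<bar>S h y - y - h *\<^sub>R v\<bar> \<le> (h * h) *\<^sub>R B"
proof -
  have B0: "0 \<le> B" using B[of 0] assms(3) abs_ge_zero order_trans by blast
  have "\<bar>S \<sigma> v - v\<bar> \<le> h *\<^sub>R B" if "0 \<le> \<sigma>" "\<sigma> \<le> h" for \<sigma>
  proof -
    have "\<bar>S \<sigma> v - v - \<sigma> *\<^sub>R 0\<bar> \<le> \<sigma> *\<^sub>R B"
      using that B by (intro mean_value_estimate[OF assms(2)]) auto
    also have "\<dots> \<le> h *\<^sub>R B" using that B0 by (intro scaleR_right_mono)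
    finally show ?thesis by simp
  qed
  from mean_value_estimate[OF assms(1,3) this] show ?thesis by simp
qed

section \<open>Integrals of orbits\<close>

text \<open>A Riemann sum of the orbit of \<open>x\<close> over the interval \<open>[0, n d]\<close>.\<close>

definition mesh_sum :: "'a \<Rightarrow> real \<Rightarrow> nat \<Rightarrow> 'a" where
  "mesh_sum x d n = d *\<^sub>R (\<Sum>k<n. S (real k * d) x)"

lemma mesh_sum_minus_const:
  "mesh_sum x d n - (real n * d) *\<^sub>R x = d *\<^sub>R (\<Sum>k<n. S (real k * d) x - x)"
  by (simp only: mesh_sum_def sum_subtractf sum_constant_scaleR card_lessThan)
     (simp add: scaleR_diff_right mult.commute)

lemma mesh_sum_near_const:
  assumes "0 \<le> d" and "\<And>h. 0 \<le> h \<Longrightarrow> h \<le> real n * d \<Longrightarrow> \<bar>S h x - x\<bar> \<le> u"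
  shows "\<bar>mesh_sum x d n - (real n * d) *\<^sub>R x\<bar> \<le> (real n * d) *\<^sub>R u"
proof -
  have "\<bar>\<Sum>k<n. S (real k * d) x - x\<bar> \<le> real n *\<^sub>R u"
    using assms by (intro abs_sum_lessThan_le assms(2)) (auto intro: mult_right_mono)
  from abs_scaleR_le[OF this assms(1)] show ?thesis
    unfolding mesh_sum_minus_const by (simp add: mult.commute)
qed

text \<open>
  Both sides are the Riemann sum over \<open>[0, (m + n) d]\<close> minus those over \<open>[0, m d]\<close> and
  \<open>[0, n d]\<close>, so they are symmetric in \<open>m\<close> and \<open>n\<close>. In the limit this becomes
  \<open>S h (F r) - F r = S r (F h) - F h\<close>, which expresses the increment of the orbit of \<open>F r\<close> through
  an integral over the short interval \<open>[0, h]\<close>.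
\<close>

lemma mesh_sum_shift:
  assumes "0 \<le> d"
  shows "S (real m * d) (mesh_sum x d n) - mesh_sum x d n
    = S (real n * d) (mesh_sum x d m) - mesh_sum x d m"
proof -
  define f where "f k = S (real k * d) x" for k
  have shift: "S (real i * d) (mesh_sum x d j) = d *\<^sub>R (\<Sum>k<j. f (i + k))" for i j
    using assms
    by (simp add: mesh_sum_def scale sum f_def add[symmetric] distrib_right)
  have "(\<Sum>k<n. f k) + (\<Sum>k<m. f (n + k)) = (\<Sum>k<m. f k) + (\<Sum>k<n. f (m + k))"
    unfolding sum_lessThan_add[symmetric] by (simp add: add.commute)
  then have "(\<Sum>k<n. f (m + k)) - (\<Sum>k<n. f k) = (\<Sum>k<m. f (n + k)) - (\<Sum>k<m. f k)"
    by (simp add: algebra_simps)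
  from arg_cong[OF this, of "scaleR d"] show ?thesis
    unfolding shift by (simp add: mesh_sum_def f_def scaleR_diff_right)
qed

lemma mesh_sum_refine:
  assumes d: "0 \<le> d" and p: "p > 0"
    and b: "\<And>h. 0 \<le> h \<Longrightarrow> h \<le> d \<Longrightarrow> \<bar>S h x - x\<bar> \<le> \<epsilon> *\<^sub>R u" "0 \<le> \<epsilon>"
    and u': "\<And>s c z. \<lbrakk>0 \<le> s; s \<le> real n * d; 0 \<le> c; \<bar>z\<bar> \<le> c *\<^sub>R u\<rbrakk> \<Longrightarrow> \<bar>S s z\<bar> \<le> c *\<^sub>R u'"
  shows "\<bar>mesh_sum x (d / real p) (n * p) - mesh_sum x d n\<bar> \<le> (real n * d * \<epsilon>) *\<^sub>R u'"
proof -
  define e where "e = d / real p"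
  have e: "0 \<le> e" "d = real p * e" using d p by (auto simp: e_def)
  have e': "real m * e \<le> d" if "m < p" for m using e that by (auto intro: mult_right_mono)
  have split: "(\<Sum>k<m * p. f k) = (\<Sum>i<m. \<Sum>j<p. f (i * p + j))"
    for f :: "nat \<Rightarrow> 'a" and m
    by (induction m) (simp_all add: sum_lessThan_add add.commute[of p])
  have "mesh_sum x e (n * p) - mesh_sum x d n
      = e *\<^sub>R (\<Sum>i<n. \<Sum>j<p. S (real (i * p + j) * e) x - S (real i * d) x)"
    unfolding mesh_sum_def split
    by (simp only: sum_subtractf sum_constant_scaleR card_lessThan)
       (simp add: scaleR_diff_right scaleR_sum_right e(2) mult.commute)
  also have "\<bar>\<dots>\<bar> \<le> e *\<^sub>R (real n *\<^sub>R real p *\<^sub>R (\<epsilon> *\<^sub>R u'))"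
  proof (intro abs_scaleR_le abs_sum_lessThan_le e(1))
    fix i j assume ij: "i < n" "j < p"
    have id: "0 \<le> real i * d" "real i * d \<le> real n * d"
      using ij d by (auto intro: mult_right_mono)
    have je: "0 \<le> real j * e" using e by simp
    have "real (i * p + j) * e = real i * d + real j * e"
      by (simp add: e(2) algebra_simps)
    then have "S (real (i * p + j) * e) x - S (real i * d) x = S (real i * d) (S (real j * e) x - x)"
      using id je by (simp add: add diff)
    also have "\<bar>\<dots>\<bar> \<le> \<epsilon> *\<^sub>R u'"
      by (rule u'[OF id b(2) b(1)[OF je e'[OF ij(2)]]])
    finally show "\<bar>S (real (i * p + j) * e) x - S (real i * d) x\<bar> \<le> \<epsilon> *\<^sub>R u'" .
  qed
  also have "\<dots> = (real n * d * \<epsilon>) *\<^sub>R u'" by (simp add: e(2) ac_simps)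
  finally show ?thesis by (simp add: e_def)
qed

text \<open>The sums with \<open>n\<close> and \<open>m\<close> points are both compared with their common refinement of \<open>n m\<close> points.\<close>

lemma ru_Cauchy_mesh_sum:
  assumes r: "0 < r"
  shows "\<exists>u\<ge>0. \<forall>\<epsilon>>0. \<exists>N. \<forall>n\<ge>N. \<forall>m\<ge>N.
    \<bar>mesh_sum x (r / real (Suc n)) (Suc n) - mesh_sum x (r / real (Suc m)) (Suc m)\<bar> \<le> \<epsilon> *\<^sub>R u"
proof -
  obtain u where u: "0 \<le> u" "\<And>\<epsilon>. \<epsilon> > 0 \<Longrightarrow> \<exists>\<delta>>0. \<forall>h. 0 \<le> h \<and> h \<le> \<delta> \<longrightarrow> \<bar>S h x - x\<bar> \<le> \<epsilon> *\<^sub>R u"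
    using continuous_at_0[of x] by blast
  obtain u' where u': "0 \<le> u'"
    "\<And>\<sigma> c z. \<lbrakk>0 \<le> \<sigma>; \<sigma> \<le> r; 0 \<le> c; \<bar>z\<bar> \<le> c *\<^sub>R u\<rbrakk> \<Longrightarrow> \<bar>S \<sigma> z\<bar> \<le> c *\<^sub>R u'"
    using regulator[OF u(1), of r] by blast
  have "\<exists>N. \<forall>n\<ge>N. \<forall>m\<ge>N. \<bar>mesh_sum x (r / real (Suc n)) (Suc n)
      - mesh_sum x (r / real (Suc m)) (Suc m)\<bar> \<le> \<epsilon> *\<^sub>R ((2 * r) *\<^sub>R u')" if \<epsilon>: "\<epsilon> > 0" for \<epsilon>
  proof -
    obtain \<delta> where \<delta>: "\<delta> > 0" "\<And>h. 0 \<le> h \<Longrightarrow> h \<le> \<delta> \<Longrightarrow> \<bar>S h x - x\<bar> \<le> \<epsilon> *\<^sub>R u"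
      using u(2)[OF \<epsilon>] by blast
    obtain N :: nat where N: "\<And>n. n \<ge> N \<Longrightarrow> r / real n \<le> \<delta>"
      using ex_small_mesh[OF \<delta>(1) order_less_imp_le[OF r]] by blast
    have refine: "\<bar>mesh_sum x (r / real n / real p) (n * p) - mesh_sum x (r / real n) n\<bar>
        \<le> (r * \<epsilon>) *\<^sub>R u'" if "n \<ge> N" "0 < n" "0 < p" for n p
      using mesh_sum_refine[of "r / real n" p x \<epsilon> u n u'] that r \<epsilon> \<delta>(2) N[of n] u'(2) by simp
    have "\<bar>mesh_sum x (r / real n) n - mesh_sum x (r / real m) m\<bar> \<le> \<epsilon> *\<^sub>R ((2 * r) *\<^sub>R u')"
      if nm: "n \<ge> N" "0 < n" "m \<ge> N" "0 < m" for n m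
    proof -
      have eq: "mesh_sum x (r / real n / real m) (n * m) = mesh_sum x (r / real m / real n) (m * n)"
        by (simp add: mult.commute)
      have "mesh_sum x (r / real n) n - mesh_sum x (r / real m) m
        = (mesh_sum x (r / real m / real n) (m * n) - mesh_sum x (r / real m) m)
          - (mesh_sum x (r / real n / real m) (n * m) - mesh_sum x (r / real n) n)"
        unfolding eq by simp
      also have "\<bar>\<dots>\<bar> \<le> (r * \<epsilon>) *\<^sub>R u' + (r * \<epsilon>) *\<^sub>R u'"
        using nm by (intro abs_diff_le refine)
      also have "\<dots> = \<epsilon> *\<^sub>R ((2 * r) *\<^sub>R u')"
        by (simp add: scaleR_add_left[symmetric])
      finally show ?thesis .
    qed
    then show ?thesis using zero_less_Suc le_SucI by blast
  qed
  moreover have "0 \<le> (2 * r) *\<^sub>R u'" using r u'(1) by (intro scaleR_nonneg_nonneg) auto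
  ultimately show ?thesis by blast
qed

text \<open>
  Fix \<open>h\<close> and replace \<open>F\<close> by a Riemann sum \<open>P\<close> of width \<open>d\<close>, and \<open>h\<close> by the multiple \<open>h'\<close> of \<open>d\<close>
  just below it. The errors carry a factor \<open>\<eta>\<close> that is arbitrarily small for fixed \<open>h\<close>. Now
  \<open>mesh_sum_shift\<close> identifies \<open>S h' P - P\<close> with \<open>S r Q - Q\<close>, where \<open>Q\<close> is the Riemann sum over
  \<open>[0, h']\<close> and hence equals \<open>h' x\<close> up to \<open>\<epsilon> h'\<close> times a regulator.
\<close>

lemma gen_mesh_sum_limit:
  assumes r: "0 < r"
    and F: "0 \<le> v" "\<And>\<epsilon>. \<epsilon> > 0 \<Longrightarrow> \<exists>N. \<forall>n\<ge>N. \<bar>mesh_sum x (r / real (Suc n)) (Suc n) - F\<bar> \<le> \<epsilon> *\<^sub>R v"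
  shows "gen F (S r x - x)"
proof -
  obtain u where u: "0 \<le> u" "\<And>\<epsilon>. \<epsilon> > 0 \<Longrightarrow> \<exists>\<delta>>0. \<forall>h. 0 \<le> h \<and> h \<le> \<delta> \<longrightarrow> \<bar>S h x - x\<bar> \<le> \<epsilon> *\<^sub>R u"
    using continuous_at_0[of x] by blast
  obtain ur where ur: "0 \<le> ur"
    "\<And>\<sigma> c z. \<lbrakk>0 \<le> \<sigma>; \<sigma> \<le> r; 0 \<le> c; \<bar>z\<bar> \<le> c *\<^sub>R u\<rbrakk> \<Longrightarrow> \<bar>S \<sigma> z\<bar> \<le> c *\<^sub>R ur"
    using regulator[OF u(1), of r] by blast
  obtain v1 where v1: "0 \<le> v1"
    "\<And>\<sigma> c z. \<lbrakk>0 \<le> \<sigma>; \<sigma> \<le> 1; 0 \<le> c; \<bar>z\<bar> \<le> c *\<^sub>R v\<rbrakk> \<Longrightarrow> \<bar>S \<sigma> z\<bar> \<le> c *\<^sub>R v1"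
    using regulator[OF F(1), of 1] by blast
  obtain w where w: "0 \<le> w" "\<And>\<epsilon>. \<epsilon> > 0 \<Longrightarrow> \<exists>\<delta>>0. \<forall>h. 0 \<le> h \<and> h \<le> \<delta> \<longrightarrow> \<bar>S h F - F\<bar> \<le> \<epsilon> *\<^sub>R w"
    using continuous_at_0[of F] by blast
  obtain w1 where w1: "0 \<le> w1"
    "\<And>\<sigma> c z. \<lbrakk>0 \<le> \<sigma>; \<sigma> \<le> 1; 0 \<le> c; \<bar>z\<bar> \<le> c *\<^sub>R w\<rbrakk> \<Longrightarrow> \<bar>S \<sigma> z\<bar> \<le> c *\<^sub>R w1"
    using regulator[OF w(1), of 1] by blast
  define y where "y = S r x - x"
  have "\<exists>\<delta>>0. \<forall>h. 0 < h \<and> h \<le> \<delta> \<longrightarrow> \<bar>S h F - F - h *\<^sub>R y\<bar> \<le> (\<epsilon> * h) *\<^sub>R (ur + u)"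
    if \<epsilon>: "\<epsilon> > 0" for \<epsilon>
  proof -
    obtain \<delta> where \<delta>: "\<delta> > 0" "\<And>h. 0 \<le> h \<Longrightarrow> h \<le> \<delta> \<Longrightarrow> \<bar>S h x - x\<bar> \<le> \<epsilon> *\<^sub>R u"
      using u(2)[OF \<epsilon>] by blast
    have "\<bar>S h F - F - h *\<^sub>R y\<bar> \<le> (\<epsilon> * h) *\<^sub>R (ur + u)" if h: "0 < h" "h \<le> min \<delta> 1" for h
    proof (rule le_if_le_add_eps)
      fix \<eta> :: real assume \<eta>: "\<eta> > 0"
      obtain \<delta>' where \<delta>': "\<delta>' > 0" "\<And>h. 0 \<le> h \<Longrightarrow> h \<le> \<delta>' \<Longrightarrow> \<bar>S h F - F\<bar> \<le> \<eta> *\<^sub>R w"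
        using w(2)[OF \<eta>] by blast
      obtain N1 where N1: "\<And>n. n \<ge> N1 \<Longrightarrow> \<bar>mesh_sum x (r / real (Suc n)) (Suc n) - F\<bar> \<le> \<eta> *\<^sub>R v"
        using F(2)[OF \<eta>] by blast
      obtain N2 where N2: "\<And>n. n \<ge> N2 \<Longrightarrow> r / real n \<le> min \<eta> \<delta>'"
        using ex_small_mesh[of "min \<eta> \<delta>'" r] \<eta> \<delta>' r by auto
      define n where "n = Suc (max N1 N2)"
      define d where "d = r / real n"
      have d: "0 < d" "d \<le> \<eta>" "d \<le> \<delta>'" "real n * d = r"
        using r N2[of n] by (auto simp: d_def n_def)
      define P where "P = mesh_sum x d n"
      have P: "\<bar>P - F\<bar> \<le> \<eta> *\<^sub>R v" unfolding P_def d_def n_def by (rule N1) simp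
      define m where "m = nat \<lfloor>h / d\<rfloor>"
      define h' where "h' = real m * d"
      have "real m = of_int \<lfloor>h / d\<rfloor>" using h d by (simp add: m_def)
      then have "real m \<le> h / d" "h / d < real m + 1" by linarith+
      then have h': "0 \<le> h'" "h' \<le> h" "h - h' \<le> d" "h' \<le> 1"
        using h d by (auto simp: h'_def field_simps)
      define Q where "Q = mesh_sum x d m"
      have Q: "\<bar>Q - h' *\<^sub>R x\<bar> \<le> h' *\<^sub>R (\<epsilon> *\<^sub>R u)"
        unfolding Q_def h'_def
        using d h h' by (intro mesh_sum_near_const \<delta>(2)) (auto simp: h'_def)
      have 1: "\<bar>S h F - S h' F\<bar> \<le> \<eta> *\<^sub>R w1"
      proof -
        have "S h F - S h' F = S h' (S (h - h') F - F)"
          using h' add[of h' "h - h'" F] by (simp add: diff)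
        also have "\<bar>\<dots>\<bar> \<le> \<eta> *\<^sub>R w1"
          using h' d \<eta> by (intro w1(2) \<delta>'(2)) auto
        finally show ?thesis .
      qed
      have 2: "\<bar>S h' (P - F)\<bar> \<le> \<eta> *\<^sub>R v1" using h' \<eta> P by (intro v1(2)) auto
      have 3: "\<bar>S h' P - P - h' *\<^sub>R y\<bar> \<le> (\<epsilon> * h) *\<^sub>R (ur + u)"
      proof -
        have "S h' P - P = S r Q - Q"
          using mesh_sum_shift[of d m x n] d by (simp add: P_def Q_def h'_def)
        then have "S h' P - P - h' *\<^sub>R y = S r (Q - h' *\<^sub>R x) - (Q - h' *\<^sub>R x)"
          using r by (simp add: diff scale y_def scaleR_diff_right)
        also have "\<bar>\<dots>\<bar> \<le> (h' * \<epsilon>) *\<^sub>R ur + (h' * \<epsilon>) *\<^sub>R u"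
          using Q r h' \<epsilon> by (intro abs_diff_le ur(2)) auto
        also have "\<dots> = (h' * \<epsilon>) *\<^sub>R (ur + u)" by (simp add: scaleR_add_right)
        also have "\<dots> \<le> (\<epsilon> * h) *\<^sub>R (ur + u)"
          using h' \<epsilon> ur(1) u(1) by (intro scaleR_right_mono) auto
        finally show ?thesis .
      qed
      have 4: "\<bar>(h - h') *\<^sub>R y\<bar> \<le> \<eta> *\<^sub>R \<bar>y\<bar>"
      proof -
        have "\<bar>(h - h') *\<^sub>R y\<bar> \<le> (h - h') *\<^sub>R \<bar>y\<bar>" using h' by (intro abs_scaleR_le) auto
        also have "\<dots> \<le> \<eta> *\<^sub>R \<bar>y\<bar>" using h' d by (intro scaleR_right_mono) auto
        finally show ?thesis .
      qed
      have "S h F - F - h *\<^sub>R y = (S h' P - P - h' *\<^sub>R y)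
          + ((S h F - S h' F) - S h' (P - F) + (P - F) - (h - h') *\<^sub>R y)"
        using h' by (simp add: diff algebra_simps)
      also have "\<bar>\<dots>\<bar> \<le> (\<epsilon> * h) *\<^sub>R (ur + u) + (\<eta> *\<^sub>R w1 + \<eta> *\<^sub>R v1 + \<eta> *\<^sub>R v + \<eta> *\<^sub>R \<bar>y\<bar>)"
        by (intro abs_add_le abs_diff_le 1 2 3 4 P)
      finally show "\<bar>S h F - F - h *\<^sub>R y\<bar> \<le> (\<epsilon> * h) *\<^sub>R (ur + u) + \<eta> *\<^sub>R (w1 + v1 + v + \<bar>y\<bar>)"
        by (simp add: scaleR_add_right)
    qed
    with \<delta>(1) show ?thesis by (intro exI[of _ "min \<delta> 1"]) auto
  qed
  moreover have "0 \<le> ur + u" using ur(1) u(1) by simp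
  ultimately show ?thesis unfolding gen_def y_def by blast
qed

lemma orbit_integral:
  obtains F u where "0 \<le> u" and "\<And>r. 0 < r \<Longrightarrow> gen (F r) (S r x - x)"
    and "\<And>\<epsilon>. \<epsilon> > 0 \<Longrightarrow> \<exists>r>0. \<bar>F r - r *\<^sub>R x\<bar> \<le> (r * \<epsilon>) *\<^sub>R u"
proof -
  obtain u where u: "0 \<le> u" "\<And>\<epsilon>. \<epsilon> > 0 \<Longrightarrow> \<exists>\<delta>>0. \<forall>h. 0 \<le> h \<and> h \<le> \<delta> \<longrightarrow> \<bar>S h x - x\<bar> \<le> \<epsilon> *\<^sub>R u"
    using continuous_at_0[of x] by blast
  have "\<forall>r. \<exists>F. 0 < r \<longrightarrow> (\<exists>v\<ge>0. \<forall>\<epsilon>>0. \<exists>N. \<forall>n\<ge>N.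
      \<bar>mesh_sum x (r / real (Suc n)) (Suc n) - F\<bar> \<le> \<epsilon> *\<^sub>R v)"
    using ru_Cauchy_imp_conv[OF ru_Cauchy_mesh_sum] by blast
  then obtain F where F: "\<And>r. 0 < r \<Longrightarrow> \<exists>v\<ge>0. \<forall>\<epsilon>>0. \<exists>N. \<forall>n\<ge>N.
      \<bar>mesh_sum x (r / real (Suc n)) (Suc n) - F r\<bar> \<le> \<epsilon> *\<^sub>R v"
    by metis
  have "\<exists>r>0. \<bar>F r - r *\<^sub>R x\<bar> \<le> (r * \<epsilon>) *\<^sub>R u" if \<epsilon>: "\<epsilon> > 0" for \<epsilon>
  proof -
    obtain r where r: "r > 0" "\<And>h. 0 \<le> h \<Longrightarrow> h \<le> r \<Longrightarrow> \<bar>S h x - x\<bar> \<le> \<epsilon> *\<^sub>R u"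
      using u(2)[OF \<epsilon>] by blast
    obtain v where v: "0 \<le> v" "\<And>\<eta>. \<eta> > 0 \<Longrightarrow> \<exists>N. \<forall>n\<ge>N.
        \<bar>mesh_sum x (r / real (Suc n)) (Suc n) - F r\<bar> \<le> \<eta> *\<^sub>R v"
      using F[OF r(1)] by blast
    have "\<bar>F r - r *\<^sub>R x\<bar> \<le> (r * \<epsilon>) *\<^sub>R u"
    proof (rule le_if_le_add_eps)
      fix \<eta> :: real assume "\<eta> > 0"
      then obtain n where n: "\<bar>mesh_sum x (r / real (Suc n)) (Suc n) - F r\<bar> \<le> \<eta> *\<^sub>R v"
        using v(2) by blast
      define P where "P = mesh_sum x (r / real (Suc n)) (Suc n)"
      have "\<bar>P - r *\<^sub>R x\<bar> \<le> r *\<^sub>R (\<epsilon> *\<^sub>R u)"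
        using mesh_sum_near_const[of "r / real (Suc n)" "Suc n" x "\<epsilon> *\<^sub>R u"] r by (simp add: P_def)
      from abs_diff_le[OF this n[folded P_def]]
      show "\<bar>F r - r *\<^sub>R x\<bar> \<le> (r * \<epsilon>) *\<^sub>R u + \<eta> *\<^sub>R v" by simp
    qed
    with r(1) show ?thesis by blast
  qed
  with u(1) F gen_mesh_sum_limit show ?thesis using that[of u F] by metis
qed

end

section \<open>Uniqueness on the real lattice\<close>

text \<open>
  With \<open>h = t / n\<close>, the difference \<open>S t x - T t x\<close> telescopes into the \<open>n\<close> terms
  \<open>T (t - (k + 1) h) (S h - T h) (S (k h) x)\<close>, each of order \<open>h\<^sup>2\<close>.
\<close>

lemma agree_on_gen_square:
  fixes S T :: "real \<Rightarrow> 'a::ru_complete_vector_lattice \<Rightarrow> 'a"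
  assumes "positive_ru_semigroup S" "positive_ru_semigroup T"
    and gen: "\<And>x y. positive_ru_semigroup.gen S x y \<Longrightarrow> positive_ru_semigroup.gen T x y"
    and x: "positive_ru_semigroup.gen S x v" "positive_ru_semigroup.gen S v w"
    and t: "0 \<le> t"
  shows "S t x = T t x"
proof -
  interpret S: positive_ru_semigroup S by fact
  interpret T: positive_ru_semigroup T by fact
  have "\<exists>a\<ge>0. \<forall>s. 0 \<le> s \<and> s \<le> t \<longrightarrow> \<bar>S s w\<bar> \<le> a" by (rule S.locally_bounded)
  then obtain a where a: "0 \<le> a" "\<And>s. 0 \<le> s \<Longrightarrow> s \<le> t \<Longrightarrow> \<bar>S s w\<bar> \<le> 1 *\<^sub>R a" by auto
  obtain b where b: "0 \<le> b"
    "\<And>s c z. \<lbrakk>0 \<le> s; s \<le> t; 0 \<le> c; \<bar>z\<bar> \<le> c *\<^sub>R a\<rbrakk> \<Longrightarrow> \<bar>S s z\<bar> \<le> c *\<^sub>R b"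
    using S.regulator[OF a(1), of t] by blast
  obtain b' where b': "0 \<le> b'"
    "\<And>s c z. \<lbrakk>0 \<le> s; s \<le> t; 0 \<le> c; \<bar>z\<bar> \<le> c *\<^sub>R a\<rbrakk> \<Longrightarrow> \<bar>T s z\<bar> \<le> c *\<^sub>R b'"
    using T.regulator[OF a(1), of t] by blast
  have "0 \<le> b + b'" using b(1) b'(1) by simp
  then obtain B where B: "0 \<le> B"
    "\<And>s c z. \<lbrakk>0 \<le> s; s \<le> t; 0 \<le> c; \<bar>z\<bar> \<le> c *\<^sub>R (b + b')\<rbrakk> \<Longrightarrow> \<bar>T s z\<bar> \<le> c *\<^sub>R B"
    using T.regulator[of "b + b'" t] by blast
  \<comment> \<open>Both operators are within a multiple of \<open>h * h\<close> of \<open>y + h *\<^sub>R A y\<close> at \<open>y = S r x\<close>.\<close>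
  have one_step: "\<bar>S h (S r x) - T h (S r x)\<bar> \<le> (h * h) *\<^sub>R (b + b')"
    if r: "0 \<le> r" "r \<le> t" and h: "0 \<le> h" "h \<le> t" for r h
  proof -
    have g: "S.gen (S r x) (S r v)" "S.gen (S r v) (S r w)"
      using x r by (auto intro: S.gen_orbit)
    have "\<bar>S h (S r x) - S r x - h *\<^sub>R S r v\<bar> \<le> (h * h) *\<^sub>R b"
      using b(2)[of _ 1 "S r w"] a(2)[OF r] h by (intro S.second_order_estimate[OF g h(1)]) auto
    moreover have "\<bar>T h (S r x) - S r x - h *\<^sub>R S r v\<bar> \<le> (h * h) *\<^sub>R b'"
      using b'(2)[of _ 1 "S r w"] a(2)[OF r] h
      by (intro T.second_order_estimate[OF gen[OF g(1)] gen[OF g(2)] h(1)]) auto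
    ultimately show ?thesis
      using abs_diff_le by (fastforce simp: scaleR_add_right)
  qed
  have "\<bar>S t x - T t x\<bar> \<le> 0"
  proof (rule le_if_le_add_eps[where u = "t *\<^sub>R B"])
    fix \<epsilon> :: real assume "\<epsilon> > 0"
    then obtain n :: nat where n: "n > 0" "t / real n \<le> \<epsilon>"
      using ex_small_mesh[OF _ t] by blast
    define h where "h = t / real n"
    have h: "0 \<le> h" "h \<le> \<epsilon>" "real n * h = t" using n t by (auto simp: h_def)
    define f where "f k = T (real (n - k) * h) (S (real k * h) x)" for k
    have "S t x - T t x = (\<Sum>k<n. f (Suc k) - f k)"
      unfolding sum_lessThan_telescope by (simp add: f_def h T.zero S.zero)
    also have "\<bar>\<dots>\<bar> \<le> real n *\<^sub>R ((h * h) *\<^sub>R B)"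
    proof (rule abs_sum_lessThan_le)
      fix k assume k: "k < n"
      have le: "0 \<le> real j * h" "real j * h \<le> t" if "j \<le> n" for j
        using that h mult_right_mono[of "real j" "real n" h] by auto
      define s where "s = real (n - Suc k) * h"
      have s: "0 \<le> s" "s \<le> t" using le[of "n - Suc k"] by (auto simp: s_def)
      have kh: "0 \<le> real k * h" "real k * h \<le> t" using le[of k] k by auto
      have "h \<le> t" using le(2)[of 1] n by simp
      have "real (n - k) * h = s + h" using k by (simp add: s_def of_nat_diff algebra_simps)
      then have "f k = T s (T h (S (real k * h) x))" using s h by (simp add: f_def T.add)
      moreover have "real (Suc k) * h = h + real k * h" by (simp add: algebra_simps)
      then have "f (Suc k) = T s (S h (S (real k * h) x))"
        using kh h by (simp add: f_def s_def S.add)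
      ultimately have "f (Suc k) - f k
          = T s (S h (S (real k * h) x) - T h (S (real k * h) x))"
        using s by (simp add: T.diff)
      also have "\<bar>\<dots>\<bar> \<le> (h * h) *\<^sub>R B"
        using s kh h \<open>h \<le> t\<close> by (intro B(2) one_step) auto
      finally show "\<bar>f (Suc k) - f k\<bar> \<le> (h * h) *\<^sub>R B" .
    qed
    also have "\<dots> = h *\<^sub>R t *\<^sub>R B" using h(3) by (simp add: ac_simps)
    also have "\<dots> \<le> \<epsilon> *\<^sub>R t *\<^sub>R B"
      using h t B(1) by (intro scaleR_right_mono scaleR_nonneg_nonneg) auto
    finally show "\<bar>S t x - T t x\<bar> \<le> 0 + \<epsilon> *\<^sub>R t *\<^sub>R B" by simp
  qed
  then show ?thesis by simp
qed

text \<open>The vectors \<open>F r / r\<close> come close to \<open>x\<close>, and positive operators respect this approximation.\<close>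

lemma agree_if_agree_on_integrals:
  fixes S T :: "real \<Rightarrow> 'a::ru_complete_vector_lattice \<Rightarrow> 'a"
  assumes "positive_ru_semigroup S" "positive_ru_semigroup T"
    and u: "0 \<le> u" "\<And>\<epsilon>. \<epsilon> > 0 \<Longrightarrow> \<exists>r>0. \<bar>F r - r *\<^sub>R x\<bar> \<le> (r * \<epsilon>) *\<^sub>R u"
    and agree: "\<And>r. 0 < r \<Longrightarrow> S t (F r) = T t (F r)"
    and t: "0 \<le> t"
  shows "S t x = T t x"
proof -
  interpret S: positive_ru_semigroup S by fact
  interpret T: positive_ru_semigroup T by fact
  obtain b where b: "0 \<le> b"
    "\<And>s c z. \<lbrakk>0 \<le> s; s \<le> t; 0 \<le> c; \<bar>z\<bar> \<le> c *\<^sub>R u\<rbrakk> \<Longrightarrow> \<bar>S s z\<bar> \<le> c *\<^sub>R b"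
    using S.regulator[OF u(1), of t] by blast
  obtain b' where b': "0 \<le> b'"
    "\<And>s c z. \<lbrakk>0 \<le> s; s \<le> t; 0 \<le> c; \<bar>z\<bar> \<le> c *\<^sub>R u\<rbrakk> \<Longrightarrow> \<bar>T s z\<bar> \<le> c *\<^sub>R b'"
    using T.regulator[OF u(1), of t] by blast
  have "\<bar>S t x - T t x\<bar> \<le> 0"
  proof (rule le_if_le_add_eps[where u = "b' + b"])
    fix \<epsilon> :: real assume \<epsilon>: "\<epsilon> > 0"
    obtain r where r: "r > 0" "\<bar>F r - r *\<^sub>R x\<bar> \<le> (r * \<epsilon>) *\<^sub>R u" using u(2)[OF \<epsilon>] by blast
    define z where "z = F r - r *\<^sub>R x"
    have "r *\<^sub>R (S t x - T t x) = T t z - S t z"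
      using t agree[OF r(1)] by (simp add: z_def S.diff T.diff S.scale T.scale scaleR_diff_right)
    then have "S t x - T t x = (1 / r) *\<^sub>R (T t z - S t z)"
      using r(1) by (metis divide_inverse mult_1 order_less_irrefl scaleR_left_imp_eq
        scaleR_scaleR right_inverse scaleR_one)
    also have "\<bar>\<dots>\<bar> \<le> (1 / r) *\<^sub>R ((r * \<epsilon>) *\<^sub>R b' + (r * \<epsilon>) *\<^sub>R b)"
      using r t \<epsilon> unfolding z_def by (intro abs_scaleR_le abs_diff_le b(2) b'(2)) auto
    also have "\<dots> = 0 + \<epsilon> *\<^sub>R (b' + b)" using r(1) by (simp add: scaleR_add_right)
    finally show "\<bar>S t x - T t x\<bar> \<le> 0 + \<epsilon> *\<^sub>R (b' + b)" .
  qed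
  then show ?thesis by simp
qed

text \<open>
  Integrals of orbits are used twice: those of vectors in the domain of the generator lie in the
  domain of its square, and those of arbitrary vectors lie in its domain.
\<close>

theorem positive_ru_semigroup_unique:
  fixes S T :: "real \<Rightarrow> 'a::ru_complete_vector_lattice \<Rightarrow> 'a"
  assumes S: "positive_ru_semigroup S" and T: "positive_ru_semigroup T"
    and gen: "\<And>x y. positive_ru_semigroup.gen S x y \<Longrightarrow> positive_ru_semigroup.gen T x y"
    and t: "0 \<le> t"
  shows "S t x = T t x"
proof -
  interpret S: positive_ru_semigroup S by fact
  interpret T: positive_ru_semigroup T by fact
  have on_domain: "S t y = T t y" if y: "S.gen y v" for y v
  proof -
    obtain F u where F: "0 \<le> u" "\<And>r. 0 < r \<Longrightarrow> S.gen (F r) (S r y - y)"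
      "\<And>\<epsilon>. \<epsilon> > 0 \<Longrightarrow> \<exists>r>0. \<bar>F r - r *\<^sub>R y\<bar> \<le> (r * \<epsilon>) *\<^sub>R u"
      by (rule S.orbit_integral[of y]) blast
    have "S t (F r) = T t (F r)" if r: "0 < r" for r
    proof (rule agree_on_gen_square[OF S T gen _ _ t])
      show "S.gen (F r) (S r y - y)" by (rule F(2)[OF r])
      show "S.gen (S r y - y) (S r v - v)" using y r by (intro S.gen_diff S.gen_orbit) auto
    qed
    with agree_if_agree_on_integrals[OF S T F(1) F(3)] t show ?thesis by blast
  qed
  obtain F u where F: "0 \<le> u" "\<And>r. 0 < r \<Longrightarrow> S.gen (F r) (S r x - x)"
    "\<And>\<epsilon>. \<epsilon> > 0 \<Longrightarrow> \<exists>r>0. \<bar>F r - r *\<^sub>R x\<bar> \<le> (r * \<epsilon>) *\<^sub>R u"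
    by (rule S.orbit_integral[of x]) blast
  show ?thesis
    using agree_if_agree_on_integrals[OF S T F(1) F(3)] on_domain[OF F(2)] t by blast
qed


section \<open>The modulus\<close>

text \<open>
  Each finite net dominates the whole family, hence also the supremum over any other finite net,
  up to a multiple of \<open>e\<close>. So the suprema over ever finer nets form a ru-Cauchy sequence, and its
  limit is the supremum of the family.
\<close>

lemma ex_lub_if_finite_nets:
  fixes g :: "'i \<Rightarrow> 'a::ru_complete_vector_lattice"
  assumes e: "0 \<le> e" and net: "\<And>\<epsilon>. \<epsilon> > 0 \<Longrightarrow>
    \<exists>K. finite K \<and> K \<noteq> {} \<and> K \<subseteq> I \<and> (\<forall>i\<in>I. \<exists>k\<in>K. g i \<le> g k + \<epsilon> *\<^sub>R e)"
  obtains m where "\<And>i. i \<in> I \<Longrightarrow> g i \<le> m" "\<And>b. (\<And>i. i \<in> I \<Longrightarrow> g i \<le> b) \<Longrightarrow> m \<le> b"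
proof -
  have "\<exists>K. finite K \<and> K \<noteq> {} \<and> K \<subseteq> I \<and> (\<forall>i\<in>I. \<exists>k\<in>K. g i \<le> g k + (1 / real (Suc n)) *\<^sub>R e)"
    for n by (rule net) simp
  then obtain K where K: "\<And>n. finite (K n)" "\<And>n. K n \<noteq> {}" "\<And>n. K n \<subseteq> I"
    "\<And>n i. i \<in> I \<Longrightarrow> \<exists>k\<in>K n. g i \<le> g k + (1 / real (Suc n)) *\<^sub>R e"
    by metis
  define M where "M n = Sup_fin (g ` K n)" for n
  have M_upper: "g i \<le> M n + (1 / real (Suc n)) *\<^sub>R e" if i: "i \<in> I" for i n
  proof -
    obtain k where k: "k \<in> K n" "g i \<le> g k + (1 / real (Suc n)) *\<^sub>R e" using K(4)[OF i] by blast
    have "g k \<le> M n" unfolding M_def using K(1) k(1) by (intro Sup_fin.coboundedI) auto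
    with k(2) show ?thesis by (meson add_right_mono order_trans)
  qed
  have M_least: "M n \<le> b" if "\<And>i. i \<in> I \<Longrightarrow> g i \<le> b" for n b
    unfolding M_def using K(1,2,3)[of n] that by (intro Sup_fin.boundedI) auto
  have M_close: "M n - M m \<le> (1 / real (Suc m)) *\<^sub>R e" for n m
    using M_least[OF M_upper] by (simp add: diff_le_eq add.commute)
  have "\<exists>N. \<forall>n\<ge>N. \<forall>m\<ge>N. \<bar>M n - M m\<bar> \<le> \<epsilon> *\<^sub>R e" if \<epsilon>: "\<epsilon> > 0" for \<epsilon>
  proof -
    obtain N where N: "\<And>n. n \<ge> N \<Longrightarrow> 1 / real n \<le> \<epsilon>" using ex_small_mesh[OF \<epsilon>, of 1] by auto
    have "M n - M m \<le> \<epsilon> *\<^sub>R e" if "m \<ge> N" for n m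
      using M_close[of n m] scaleR_right_mono[OF N[of "Suc m"] e] that by (meson le_SucI order_trans)
    then show ?thesis by (intro exI[of _ N]) (auto simp: abs_le_iff)
  qed
  with ru_Cauchy_imp_conv[of M] e obtain L u where L: "0 \<le> u"
    "\<And>\<epsilon>. \<epsilon> > 0 \<Longrightarrow> \<exists>N. \<forall>n\<ge>N. \<bar>M n - L\<bar> \<le> \<epsilon> *\<^sub>R u" by blast
  have "g i \<le> L" if i: "i \<in> I" for i
  proof (rule le_if_le_add_eps)
    fix \<epsilon> :: real assume \<epsilon>: "\<epsilon> > 0"
    obtain N where N: "\<And>n. n \<ge> N \<Longrightarrow> 1 / real n \<le> \<epsilon>" using ex_small_mesh[OF \<epsilon>, of 1] by auto
    obtain N' where N': "\<And>n. n \<ge> N' \<Longrightarrow> \<bar>M n - L\<bar> \<le> \<epsilon> *\<^sub>R u" using L(2)[OF \<epsilon>] by blast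
    define n where "n = max N N'"
    have "M n - L \<le> \<epsilon> *\<^sub>R u" using N'[of n] by (simp add: n_def abs_le_iff)
    moreover have "(1 / real (Suc n)) *\<^sub>R e \<le> \<epsilon> *\<^sub>R e"
      using N[of "Suc n"] e by (intro scaleR_right_mono) (auto simp: n_def)
    ultimately have "(M n - L) + (1 / real (Suc n)) *\<^sub>R e \<le> \<epsilon> *\<^sub>R u + \<epsilon> *\<^sub>R e" by (rule add_mono)
    with M_upper[OF i, of n] show "g i \<le> L + \<epsilon> *\<^sub>R (u + e)"
      by (simp add: scaleR_add_right algebra_simps)
  qed
  moreover have "L \<le> b" if "\<And>i. i \<in> I \<Longrightarrow> g i \<le> b" for b
  proof (rule le_if_le_add_eps)
    fix \<epsilon> :: real assume "\<epsilon> > 0"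
    then obtain n where "\<bar>M n - L\<bar> \<le> \<epsilon> *\<^sub>R u" using L(2) by blast
    then have "L \<le> M n + \<epsilon> *\<^sub>R u" by (simp add: abs_le_iff algebra_simps)
    also have "\<dots> \<le> b + \<epsilon> *\<^sub>R u" using M_least[OF that] by (rule add_right_mono)
    finally show "L \<le> b + \<epsilon> *\<^sub>R u" .
  qed
  ultimately show ?thesis using that by blast
qed

text \<open>
  The circle is totally bounded, and the expression under the supremum changes by at most
  \<open>\<epsilon> (\<bar>x\<bar> + \<bar>y\<bar>)\<close> between points of the circle at distance \<open>\<epsilon>\<close>.
\<close>

lemma modulus_is_lub:
  fixes z :: "'a::ru_complete_vector_lattice cvl"
  shows "\<And>\<theta>. \<theta> \<in> {0..<2 * pi} \<Longrightarrow> \<bar>cos \<theta> *\<^sub>R fst z + sin \<theta> *\<^sub>R snd z\<bar> \<le> modulus z"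
    and "\<And>b. (\<And>\<theta>. \<theta> \<in> {0..<2 * pi} \<Longrightarrow> \<bar>cos \<theta> *\<^sub>R fst z + sin \<theta> *\<^sub>R snd z\<bar> \<le> b) \<Longrightarrow> modulus z \<le> b"
proof -
  define g where "g \<theta> = \<bar>cos \<theta> *\<^sub>R fst z + sin \<theta> *\<^sub>R snd z\<bar>" for \<theta>
  let ?I = "{0..<2 * pi}" and ?e = "\<bar>fst z\<bar> + \<bar>snd z\<bar>"
  have net: "\<exists>K. finite K \<and> K \<noteq> {} \<and> K \<subseteq> ?I \<and> (\<forall>i\<in>?I. \<exists>k\<in>K. g i \<le> g k + \<epsilon> *\<^sub>R ?e)"
    if \<epsilon>: "\<epsilon> > 0" for \<epsilon>
  proof -
    have "seq_compact (sphere (0::complex) 1)" by (simp add: compact_imp_seq_compact)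
    then obtain C where C: "finite C" "C \<subseteq> sphere (0::complex) 1" "sphere 0 1 \<subseteq> (\<Union>w\<in>C. ball w \<epsilon>)"
      using seq_compact_imp_totally_bounded \<epsilon> by metis
    have near: "\<exists>k\<in>Arg2pi ` C. g i \<le> g k + \<epsilon> *\<^sub>R ?e" for i
    proof -
      have "cis i \<in> sphere 0 1" by simp
      then obtain w where w: "w \<in> C" "dist w (cis i) < \<epsilon>" using C(3) by fastforce
      define k where "k = Arg2pi w"
      have "norm w = 1" using w(1) C(2) by auto
      then have "w = cis k" using Arg2pi_eq[of w] by (simp add: k_def cis_conv_exp)
      with w(2) have d: "norm (cis i - cis k) < \<epsilon>" by (simp add: dist_norm norm_minus_commute)
      have "\<bar>cos i - cos k\<bar> \<le> \<epsilon>" "\<bar>sin i - sin k\<bar> \<le> \<epsilon>"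
        using abs_Re_le_cmod[of "cis i - cis k"] abs_Im_le_cmod[of "cis i - cis k"] d by auto
      then have "\<bar>(cos i - cos k) *\<^sub>R fst z + (sin i - sin k) *\<^sub>R snd z\<bar> \<le> \<epsilon> *\<^sub>R \<bar>fst z\<bar> + \<epsilon> *\<^sub>R \<bar>snd z\<bar>"
        by (intro abs_add_le abs_scaleR_le_of_abs_le)
      from abs_add_le[OF order_refl[of "g k", unfolded g_def] this]
      have "g i \<le> g k + \<epsilon> *\<^sub>R ?e" by (simp add: g_def scaleR_add_right algebra_simps)
      with w(1) show ?thesis unfolding k_def by blast
    qed
    show ?thesis
      using C(1) near Arg2pi by (intro exI[of _ "Arg2pi ` C"]) auto
  qed
  have "0 \<le> ?e" by simp
  from ex_lub_if_finite_nets[OF this net] obtain m where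
    m: "\<And>\<theta>. \<theta> \<in> ?I \<Longrightarrow> g \<theta> \<le> m" "\<And>b. (\<And>\<theta>. \<theta> \<in> ?I \<Longrightarrow> g \<theta> \<le> b) \<Longrightarrow> m \<le> b" by blast
  have "modulus z = m"
    unfolding modulus_def g_def[symmetric] using m by (intro Least_equality) auto
  with m show "\<And>\<theta>. \<theta> \<in> ?I \<Longrightarrow> \<bar>cos \<theta> *\<^sub>R fst z + sin \<theta> *\<^sub>R snd z\<bar> \<le> modulus z"
    and "\<And>b. (\<And>\<theta>. \<theta> \<in> ?I \<Longrightarrow> \<bar>cos \<theta> *\<^sub>R fst z + sin \<theta> *\<^sub>R snd z\<bar> \<le> b) \<Longrightarrow> modulus z \<le> b"
    unfolding g_def by auto
qed

lemma abs_fst_le_modulus: "\<bar>fst z\<bar> \<le> modulus z"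
  using modulus_is_lub(1)[of 0 z] by simp

lemma abs_snd_le_modulus: "\<bar>snd z\<bar> \<le> modulus z"
  using modulus_is_lub(1)[of "pi / 2" z] by simp

lemma modulus_of_real_part: "modulus (x, 0) = \<bar>x\<bar>"
proof (rule antisym)
  show "modulus (x, 0) \<le> \<bar>x\<bar>"
    using abs_scaleR_le_of_abs_le[OF abs_cos_le_one] by (intro modulus_is_lub(2)) simp
  show "\<bar>x\<bar> \<le> modulus (x, 0)" using abs_fst_le_modulus[of "(x, 0)"] by simp
qed

section \<open>Reduction to the real lattice\<close>

text \<open>
  Relative uniform limits of pairs are unique because the modulus dominates both components. This
  makes the definite description in \<open>generator\<close> meaningful.
\<close>

lemma ru_deriv_at_0_unique:
  assumes "ru_deriv_at_0 T z p" "ru_deriv_at_0 T z q"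
  shows "p = q"
proof -
  let ?D = "\<lambda>h. (1 / h) *\<^sub>R (T h z - z)"
  obtain u where u: "\<And>\<epsilon>. \<epsilon> > 0 \<Longrightarrow> \<exists>a>0. \<forall>h>0. h \<le> a \<longrightarrow> modulus (?D h - p) \<le> \<epsilon> *\<^sub>R u"
    using assms(1) unfolding ru_deriv_at_0_def ru_net_conv_def greaterThan_iff Bex_def Ball_def by blast
  obtain v where v: "\<And>\<epsilon>. \<epsilon> > 0 \<Longrightarrow> \<exists>a>0. \<forall>h>0. h \<le> a \<longrightarrow> modulus (?D h - q) \<le> \<epsilon> *\<^sub>R v"
    using assms(2) unfolding ru_deriv_at_0_def ru_net_conv_def greaterThan_iff Bex_def Ball_def by blast
  have close: "\<exists>h. modulus (?D h - p) \<le> \<epsilon> *\<^sub>R u \<and> modulus (?D h - q) \<le> \<epsilon> *\<^sub>R v" if \<epsilon>: "\<epsilon> > 0" for \<epsilon>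
  proof -
    obtain a b where "a > 0" "\<forall>h>0. h \<le> a \<longrightarrow> modulus (?D h - p) \<le> \<epsilon> *\<^sub>R u"
      "b > 0" "\<forall>h>0. h \<le> b \<longrightarrow> modulus (?D h - q) \<le> \<epsilon> *\<^sub>R v"
      using u[OF \<epsilon>] v[OF \<epsilon>] by blast
    then show ?thesis by (intro exI[of _ "min a b"]) auto
  qed
  have "\<bar>fst p - fst q\<bar> \<le> 0"
  proof (rule le_if_le_add_eps)
    fix \<epsilon> :: real assume "\<epsilon> > 0"
    then obtain h where h: "modulus (?D h - p) \<le> \<epsilon> *\<^sub>R u" "modulus (?D h - q) \<le> \<epsilon> *\<^sub>R v"
      using close by blast
    from abs_diff_le[OF order_trans[OF abs_fst_le_modulus h(2)] order_trans[OF abs_fst_le_modulus h(1)]]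
    show "\<bar>fst p - fst q\<bar> \<le> 0 + \<epsilon> *\<^sub>R (v + u)" by (simp add: scaleR_add_right)
  qed
  moreover have "\<bar>snd p - snd q\<bar> \<le> 0"
  proof (rule le_if_le_add_eps)
    fix \<epsilon> :: real assume "\<epsilon> > 0"
    then obtain h where h: "modulus (?D h - p) \<le> \<epsilon> *\<^sub>R u" "modulus (?D h - q) \<le> \<epsilon> *\<^sub>R v"
      using close by blast
    from abs_diff_le[OF order_trans[OF abs_snd_le_modulus h(2)] order_trans[OF abs_snd_le_modulus h(1)]]
    show "\<bar>snd p - snd q\<bar> \<le> 0 + \<epsilon> *\<^sub>R (v + u)" by (simp add: scaleR_add_right)
  qed
  ultimately show ?thesis by (simp add: prod_eq_iff)
qed

lemma clinear_op_add: "clinear_op f \<Longrightarrow> f (a + b) = f a + f b"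
  unfolding Vector_Spaces.linear_def module_hom_def module_hom_axioms_def by blast

lemma clinear_op_scaleC: "clinear_op f \<Longrightarrow> f (scaleC c a) = scaleC c (f a)"
  unfolding Vector_Spaces.linear_def module_hom_def module_hom_axioms_def by blast

lemma clinear_op_scaleR: "clinear_op f \<Longrightarrow> f (r *\<^sub>R a) = r *\<^sub>R f a"
  using clinear_op_scaleC[of f "of_real r"] by (simp add: scaleC_of_real)

lemma clinear_op_minus: "clinear_op f \<Longrightarrow> f (a - b) = f a - f b"
  using clinear_op_add[of f a "- b"] clinear_op_scaleR[of f "-1" b] by simp

lemma clinear_op_cartesian:
  assumes "clinear_op f"
  shows "f (x, y) = f (x, 0) + scaleC \<i> (f (y, 0))"
proof -
  have "(x, y) = (x, 0) + scaleC \<i> (y, 0)" by (simp add: scaleC_def)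
  then show ?thesis using assms by (metis clinear_op_add clinear_op_scaleC)
qed

text \<open>Decompose \<open>x\<close> into its positive and negative parts.\<close>

lemma positive_op_real:
  assumes "clinear_op f" "positive_op f"
  shows "f (x, 0) = (fst (f (x, 0)), 0)"
proof -
  have pos: "snd (f (y, 0)) = 0" if "0 \<le> y" for y
    using assms(2) that unfolding positive_op_def by force
  have "(x, 0) = (pprt x, 0 :: 'a) - (- nprt x, 0)" by (simp add: prts[symmetric])
  then have "f (x, 0) = f (pprt x, 0) - f (- nprt x, 0)"
    using assms(1) by (metis clinear_op_minus)
  then have "snd (f (x, 0)) = 0" using pos[of "pprt x"] pos[of "- nprt x"] by simp
  then show ?thesis by (simp add: prod_eq_iff)
qed

definition real_restriction :: "(real \<Rightarrow> 'a::zero cvl \<Rightarrow> 'a cvl) \<Rightarrow> real \<Rightarrow> 'a \<Rightarrow> 'a" where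
  "real_restriction T t x = fst (T t (x, 0))"

lemma real_restriction:
  assumes "ruc_semigroup T" "positive_semigroup T" "0 \<le> t"
  shows "T t (x, 0) = (real_restriction T t x, 0)"
  using assms positive_op_real[of "T t" x]
  by (simp add: real_restriction_def ruc_semigroup_def positive_semigroup_def)

lemma positive_ru_semigroup_real_restriction:
  fixes T :: "real \<Rightarrow> 'a::ru_complete_vector_lattice cvl \<Rightarrow> 'a cvl"
  assumes ruc: "ruc_semigroup T" and pos: "positive_semigroup T" and bdd: "exp_order_bounded T"
  shows "positive_ru_semigroup (real_restriction T)" (is "positive_ru_semigroup ?R")
proof -
  have lin: "clinear_op (T t)" if "0 \<le> t" for t using ruc that by (simp add: ruc_semigroup_def)
  note real = real_restriction[OF ruc pos]
  show ?thesis
  proof (rule positive_ru_semigroup.intro)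
    fix t :: real assume t: "0 \<le> t"
    show "linear (?R t)"
    proof (rule linearI)
      show "?R t (x + y) = ?R t x + ?R t y" for x y
        using clinear_op_add[OF lin[OF t], of "(x, 0)" "(y, 0)"] by (simp add: real_restriction_def)
      show "?R t (r *\<^sub>R x) = r *\<^sub>R ?R t x" for r x
        using clinear_op_scaleR[OF lin[OF t], of r "(x, 0)"] by (simp add: real_restriction_def)
    qed
    show "0 \<le> ?R t x" if "0 \<le> x" for x
      using pos t that unfolding positive_semigroup_def positive_op_def real_restriction_def by force
  next
    show "?R 0 x = x" for x using ruc by (simp add: real_restriction_def ruc_semigroup_def)
  next
    fix s t :: real and x assume st: "0 \<le> s" "0 \<le> t"
    have "T (s + t) = T s \<circ> T t" using ruc st by (simp add: ruc_semigroup_def)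
    then have "T (s + t) (x, 0) = T s (?R t x, 0)" using real[OF st(2)] by simp
    then show "?R (s + t) x = ?R s (?R t x)" by (simp add: real_restriction_def)
  next
    fix x
    have "ru_continuous (\<lambda>t. T t (x, 0))" using ruc by (simp add: ruc_semigroup_def)
    then obtain u where u: "0 \<le> u (0::real)" "\<And>\<epsilon>. \<epsilon> > 0 \<Longrightarrow> \<exists>\<delta>>0. \<forall>t\<ge>0. \<forall>h\<in>{- min \<delta> t..\<delta>}.
        modulus (T (t + h) (x, 0) - T t (x, 0)) \<le> \<epsilon> *\<^sub>R u t"
      unfolding ru_continuous_def by blast
    have "\<exists>\<delta>>0. \<forall>h. 0 \<le> h \<and> h \<le> \<delta> \<longrightarrow> \<bar>?R h x - x\<bar> \<le> \<epsilon> *\<^sub>R u 0" if \<epsilon>: "\<epsilon> > 0" for \<epsilon>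
    proof -
      obtain \<delta> where \<delta>: "\<delta> > 0" "\<And>t h. 0 \<le> t \<Longrightarrow> h \<in> {- min \<delta> t..\<delta>} \<Longrightarrow>
          modulus (T (t + h) (x, 0) - T t (x, 0)) \<le> \<epsilon> *\<^sub>R u t"
        using u(2)[OF \<epsilon>] by blast
      have "T 0 (x, 0) = (x, 0)" using ruc by (simp add: ruc_semigroup_def)
      then have "\<bar>?R h x - x\<bar> \<le> \<epsilon> *\<^sub>R u 0" if "0 \<le> h" "h \<le> \<delta>" for h
        using \<delta>(2)[of 0 h] that \<delta>(1) by (simp add: real modulus_of_real_part)
      with \<delta>(1) show ?thesis by blast
    qed
    with u(1) show "\<exists>u\<ge>0. \<forall>\<epsilon>>0. \<exists>\<delta>>0. \<forall>h. 0 \<le> h \<and> h \<le> \<delta> \<longrightarrow> \<bar>?R h x - x\<bar> \<le> \<epsilon> *\<^sub>R u" by blast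
  next
    fix t :: real and x
    from bdd obtain w u where u: "0 \<le> u"
      "\<And>s. 0 \<le> s \<Longrightarrow> modulus (T s (x, 0)) \<le> exp (w * s) *\<^sub>R u"
      unfolding exp_order_bounded_def by blast
    have "\<bar>?R s x\<bar> \<le> exp (\<bar>w\<bar> * t) *\<^sub>R u" if "0 \<le> s" "s \<le> t" for s
    proof -
      have "\<bar>?R s x\<bar> \<le> exp (w * s) *\<^sub>R u" using u(2) that by (simp add: real modulus_of_real_part)
      also have "w * s \<le> \<bar>w\<bar> * t" using that by (intro mult_mono) auto
      then have "exp (w * s) *\<^sub>R u \<le> exp (\<bar>w\<bar> * t) *\<^sub>R u" using u(1) by (intro scaleR_right_mono) auto
      finally show ?thesis .
    qed
    then show "\<exists>u\<ge>0. \<forall>s. 0 \<le> s \<and> s \<le> t \<longrightarrow> \<bar>?R s x\<bar> \<le> u"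
      using u(1) by (intro exI[of _ "exp (\<bar>w\<bar> * t) *\<^sub>R u"]) (auto intro: scaleR_nonneg_nonneg)
  qed
qed

lemma ru_deriv_at_0_real_iff:
  fixes T :: "real \<Rightarrow> 'a::ru_complete_vector_lattice cvl \<Rightarrow> 'a cvl"
  assumes "ruc_semigroup T" "positive_semigroup T" "exp_order_bounded T"
  shows "ru_deriv_at_0 T (x, 0) (y, 0) \<longleftrightarrow> positive_ru_semigroup.gen (real_restriction T) x y"
proof -
  interpret R: positive_ru_semigroup "real_restriction T"
    by (rule positive_ru_semigroup_real_restriction[OF assms])
  have quotient_iff: "modulus ((1 / h) *\<^sub>R (T h (x, 0) - (x, 0)) - (y, 0)) \<le> \<epsilon> *\<^sub>R u \<longleftrightarrow>
      \<bar>real_restriction T h x - x - h *\<^sub>R y\<bar> \<le> (\<epsilon> * h) *\<^sub>R u" if h: "0 < h" for h \<epsilon> u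
  proof -
    define q where "q = (1 / h) *\<^sub>R (real_restriction T h x - x) - y"
    have q: "real_restriction T h x - x - h *\<^sub>R y = h *\<^sub>R q" "q = (1 / h) *\<^sub>R (h *\<^sub>R q)"
      using h by (simp_all add: q_def scaleR_diff_right)
    have "\<bar>q\<bar> \<le> \<epsilon> *\<^sub>R u \<longleftrightarrow> \<bar>h *\<^sub>R q\<bar> \<le> (\<epsilon> * h) *\<^sub>R u"
      using abs_scaleR_le[of q "\<epsilon> *\<^sub>R u" h] abs_scaleR_le[of "h *\<^sub>R q" "(\<epsilon> * h) *\<^sub>R u" "1 / h"] h
      by (auto simp: mult.commute)
    with h show ?thesis
      by (simp add: real_restriction[OF assms(1,2)] modulus_of_real_part q_def[symmetric] q(1))
  qed
  have "(\<exists>a\<in>{0<..}. \<forall>h\<in>{0<..}. h \<le> a \<longrightarrow>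
        modulus ((1 / h) *\<^sub>R (T h (x, 0) - (x, 0)) - (y, 0)) \<le> \<epsilon> *\<^sub>R u) \<longleftrightarrow>
      (\<exists>\<delta>>0. \<forall>h. 0 < h \<and> h \<le> \<delta> \<longrightarrow> \<bar>real_restriction T h x - x - h *\<^sub>R y\<bar> \<le> (\<epsilon> * h) *\<^sub>R u)" for \<epsilon> u
    unfolding Bex_def Ball_def greaterThan_iff using quotient_iff by meson
  then show ?thesis unfolding ru_deriv_at_0_def ru_net_conv_def R.gen_def by simp
qed

theorem proposition5p8:
  fixes S T :: "real \<Rightarrow> 'a::ru_complete_vector_lattice cvl \<Rightarrow> 'a cvl"
  assumes "ru_complete (modulus :: 'a cvl \<Rightarrow> 'a)"
    and "property_D TYPE('a)"
    and "ruc_semigroup S" and "positive_semigroup S" and "exp_order_bounded S"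
    and "ruc_semigroup T" and "positive_semigroup T" and "exp_order_bounded T"
    and "generator_dom S = generator_dom T"
    and "\<And>x. x \<in> generator_dom S \<Longrightarrow> generator S x = generator T x"
  shows "\<forall>t\<ge>0. S t = T t"
proof (intro allI impI)
  fix t :: real assume t: "0 \<le> t"
  note S = assms(3-5) and T = assms(6-8)
  have generator_eq: "generator V z = y" if "ru_deriv_at_0 V z y"
    for V :: "real \<Rightarrow> 'a cvl \<Rightarrow> 'a cvl" and z y
    unfolding generator_def using that ru_deriv_at_0_unique by blast
  have "positive_ru_semigroup.gen (real_restriction T) x y"
    if "positive_ru_semigroup.gen (real_restriction S) x y" for x y
  proof -
    have Sy: "ru_deriv_at_0 S (x, 0) (y, 0)" using that ru_deriv_at_0_real_iff[OF S] by blast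
    then have dom: "(x, 0) \<in> generator_dom S" by (auto simp: generator_dom_def)
    then obtain z where z: "ru_deriv_at_0 T (x, 0) z" using assms(9) unfolding generator_dom_def by blast
    have "z = (y, 0)"
      using generator_eq[OF Sy] generator_eq[OF z] assms(10)[OF dom] by simp
    with z show ?thesis using ru_deriv_at_0_real_iff[OF T] by blast
  qed
  then have "real_restriction S t x = real_restriction T t x" for x
    using positive_ru_semigroup_unique positive_ru_semigroup_real_restriction S T t by blast
  then have real: "S t (x, 0) = T t (x, 0)" for x
    using real_restriction S T t by metis
  have lin: "clinear_op (S t)" "clinear_op (T t)" using S(1) T(1) t by (auto simp: ruc_semigroup_def)
  show "S t = T t"
  proof
    fix z :: "'a cvl"
    show "S t z = T t z"
      using real clinear_op_cartesian[OF lin(1)] clinear_op_cartesian[OF lin(2)] by (metis surj_pair)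
  qed
qed

end
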